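(* Suppose $0<\rho\le1$, $0\le\delta<1$, $\delta\le\rho$, $m\in\mathbb R$ and $a\in APS^m_{\rho,\delta}$. If there exists $\xi_0\in\mathbb R^d$ such that $a(x,\xi_0)=\mathscr M(a(\cdot,\xi_0))$ for all $x\in\mathbb R^d$, then $\mathscr M(a(\cdot,\xi_0))\in\sigma_{B^2,\mathrm{ess}}(\overline{a(x,D)})$.
   Context: Notation: $\langle\xi\rangle=(1+|\xi|^2)^{1/2}$, $e_\lambda(x)=e^{2\pi i\lambda\cdot x}$. $TP(\mathbb R^d)$: finite linear combinations of the $e_\lambda$, $\lambda\in\mathbb R^d$. $C_{\rm ap}(\mathbb R^d)$: uniform limits of trigonometric polynomials. Mean value $\mathscr M(f)=\lim_{T\to\infty}T^{-d}\int_{[0,T]^d}f(x)\,dx$. $B^2=B^2(\mathbb R^d)$: completion of $C_{\rm ap}(\mathbb R^d)$ for $(f,g)_B=\mathscr M(f\overline g)$. Symbols: $APS^m_{\rho,\delta}$ is the set of $a\in C^\infty(\mathbb R^{2d})$ such that $a(\cdot,\xi)\in C_{\rm ap}(\mathbb R^d)$ for all $\xi$ and $\sup_{x,\xi}\langle\xi\rangle^{-m+\rho|\alpha|-\delta|\beta|}|\partial_\xi^\alpha\partial_x^\beta a(x,\xi)|<\infty$ for all $\alpha,\beta$. Operator: $a(x,D)$ acts on $TP(\mathbb R^d)$ by $a(x,D)e_\lambda=a(\cdot,\lambda)e_\lambda$; $\overline{a(x,D)}$ is its closure as an unbounded operator on $B^2$ with initial domain $TP(\mathbb R^d)$. Essential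 spectrum: for a closed densely defined operator $T$ on $H$, $s\in\sigma_{H,\mathrm{ess}}(T)$ iff $T-sI$ is not Fredholm, where a closed operator is Fredholm if its kernel and cokernel $H/\mathrm{Ran}$ are finite-dimensional. *)

theory Defs
  imports "HOL-Analysis.Analysis"
begin

section \<open>Almost periodic functions and the mean value\<close>

definition expo :: "real^'n \<Rightarrow> real^'n \<Rightarrow> complex" where
  "expo l x = exp (2 * of_real pi * \<i> * of_real (l \<bullet> x))"

definition trig_poly :: "(real^'n \<Rightarrow> complex) set" where
  "trig_poly = {f. \<exists>F c. finite F \<and> f = (\<lambda>x. \<Sum>l\<in>F. c l * expo l x)}"

definition C_ap :: "(real^'n \<Rightarrow> complex) set" where
  "C_ap = {f. \<exists>p. (\<forall>k. p k \<in> trig_poly) \<and> uniform_limit UNIV p f sequentially}"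

definition cube_avg :: "(real^'n \<Rightarrow> complex) \<Rightarrow> real \<Rightarrow> complex" where
  "cube_avg f T = (1 / T ^ CARD('n)) *\<^sub>R integral (cbox 0 (\<chi> i. T)) f"

definition mean :: "(real^'n \<Rightarrow> complex) \<Rightarrow> complex" where
  "mean f = Lim at_top (cube_avg f)"

definition ip_B :: "(real^'n \<Rightarrow> complex) \<Rightarrow> (real^'n \<Rightarrow> complex) \<Rightarrow> complex" where
  "ip_B f g = mean (\<lambda>x. f x * cnj (g x))"

definition norm_B :: "(real^'n \<Rightarrow> complex) \<Rightarrow> real" where
  "norm_B f = sqrt (Re (ip_B f f))"

subsection \<open>Existence of the mean value\<close>

lemma cube_content: "0 \<le> T \<Longrightarrow> measure lborel (cbox (0::real^'n) (\<chi> i. T)) = T ^ CARD('n)"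
  by (subst content_cbox_cart) (auto simp: interval_ne_empty_cart)

lemma cube_avg_bound:
  fixes f :: "real^'n \<Rightarrow> complex"
  assumes c: "continuous_on UNIV f" and b: "\<And>x. norm (f x) \<le> B" and T: "T > 0"
  shows "norm (cube_avg f T) \<le> B"
proof -
  have B: "0 \<le> B" using b[of 0] norm_ge_zero order_trans by blast
  have "f integrable_on cbox 0 (\<chi> i. T)"
    by (rule integrable_continuous) (use c continuous_on_subset in blast)
  then have "norm (integral (cbox 0 (\<chi> i. T)) f) \<le> B * measure lborel (cbox (0::real^'n) (\<chi> i. T))"
    by (intro has_integral_bound[OF B]) (use b in auto)
  also have "\<dots> = B * T ^ CARD('n)" using T by (simp add: cube_content)
  finally show ?thesis using T by (simp add: cube_avg_def field_simps)
qed

lemma continuous_integrable_cube: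
  fixes f :: "real^'n \<Rightarrow> complex"
  assumes "continuous_on UNIV f"
  shows "f integrable_on cbox a b"
  by (rule integrable_continuous) (use assms continuous_on_subset in blast)

lemma cube_avg_add:
  fixes f :: "real^'n \<Rightarrow> complex"
  assumes "continuous_on UNIV f" "continuous_on UNIV g"
  shows "cube_avg (\<lambda>x. f x + g x) T = cube_avg f T + cube_avg g T"
  using assms
  by (simp add: cube_avg_def integral_add continuous_integrable_cube scaleR_add_right)

lemma cube_avg_mult:
  fixes f :: "real^'n \<Rightarrow> complex"
  shows "cube_avg (\<lambda>x. c * f x) T = c * cube_avg f T"
  by (simp add: cube_avg_def)

lemma cube_avg_diff:
  fixes f :: "real^'n \<Rightarrow> complex"
  assumes "continuous_on UNIV f" "continuous_on UNIV g"
  shows "cube_avg (\<lambda>x. f x - g x) T = cube_avg f T - cube_avg g T"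
  using assms
  by (simp add: cube_avg_def integral_diff continuous_integrable_cube scaleR_diff_right)

lemma cube_avg_cnj:
  fixes f :: "real^'n \<Rightarrow> complex"
  shows "cube_avg (\<lambda>x. cnj (f x)) T = cnj (cube_avg f T)"
  by (simp add: cube_avg_def integral_cnj)

lemma expo_cis: "expo l x = cis (2 * pi * (l \<bullet> x))"
  unfolding expo_def cis_conv_exp by (simp add: mult_ac)

lemma norm_expo [simp]: "norm (expo l x) = 1"
  by (simp add: expo_cis)

lemma continuous_expo [continuous_intros]: "continuous_on S (expo l)"
  unfolding expo_def by (intro continuous_intros)

lemma expo_mult: "expo l x * expo k x = expo (l + k) x"
  by (simp add: expo_cis cis_mult inner_add_left algebra_simps)

lemma cnj_expo: "cnj (expo l x) = expo (- l) x"
  by (simp add: expo_cis cis_cnj)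

lemma expo_0 [simp]: "expo 0 x = 1"
  by (simp add: expo_def)

lemma expo_avg_bound:
  fixes l :: "real^'n"
  assumes li: "l $ i \<noteq> 0" and t: "t = 1 / (2 * \<bar>l $ i\<bar>)" and T: "T \<ge> t"
  shows "norm (cube_avg (expo l) T) \<le> t / T"
proof -
  have t0: "t > 0" using li t by simp
  with T have T0: "T > 0" by simp
  define h :: "real^'n" where "h = axis i t"
  define vT :: "real^'n" where "vT = (\<chi> j. T)"
  let ?f = "expo l"
  have hj: "h $ j = (if j = i then t else 0)" for j by (simp add: h_def axis_def)
  have lh: "l \<bullet> h = l $ i * t" by (simp add: h_def inner_axis)
  have "expo l h = -1"
  proof -
    have "2 * pi * (l \<bullet> h) = pi \<or> 2 * pi * (l \<bullet> h) = - pi"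
      using li unfolding lh t by (cases "l $ i > 0") (auto simp: field_simps)
    then show ?thesis unfolding expo_cis by (metis cis_pi cis_cnj complex_cnj_minus complex_cnj_one)
  qed
  then have anti: "?f (h + x) = - ?f x" for x
    by (simp add: expo_cis inner_add_right distrib_left flip: cis_mult)
  have int: "?f integrable_on cbox a b" for a b
    by (rule continuous_integrable_cube) (rule continuous_expo)
  have I2: "integral (cbox (0 + h) (vT + h)) ?f = - integral (cbox 0 vT) ?f"
    unfolding integral_shift_cbox_plus[symmetric] by (simp add: o_def anti)
  have ax: "axis i 1 \<in> (Basis :: (real^'n) set)" by simp
  define A where "A = cbox (0::real^'n) (\<chi> j. if j = i then t else T)"
  define B where "B = cbox (\<chi> j. if j = i then T else 0) (vT + h)"
  have s1: "cbox 0 vT \<inter> {x. x \<bullet> axis i 1 \<le> t} = A"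
    using T by (auto simp: A_def vT_def mem_box_cart inner_axis split: if_splits)
      (metis order_trans)
  have s2: "cbox 0 vT \<inter> {x. x \<bullet> axis i 1 \<ge> t} = cbox h vT"
    using T t0 by (auto simp: vT_def mem_box_cart inner_axis hj split: if_splits)
      (metis order_trans less_imp_le)+
  have s3: "cbox (0 + h) (vT + h) \<inter> {x. x \<bullet> axis i 1 \<le> T} = cbox h vT"
    using T t0 by (auto simp: vT_def mem_box_cart inner_axis hj split: if_splits)
      (smt (verit))+
  have s4: "cbox (0 + h) (vT + h) \<inter> {x. x \<bullet> axis i 1 \<ge> T} = B"
    using T t0 by (auto simp: B_def vT_def mem_box_cart inner_axis hj split: if_splits)
      (smt (verit))+
  have e1: "integral (cbox 0 vT) ?f = integral A ?f + integral (cbox h vT) ?f"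
    using integral_split[OF int ax, of 0 vT t] by (simp only: s1 s2)
  have e2: "integral (cbox (0 + h) (vT + h)) ?f = integral (cbox h vT) ?f + integral B ?f"
    using integral_split[OF int ax, of "0 + h" "vT + h" T] by (simp only: s3 s4)
  have two: "2 * integral (cbox 0 vT) ?f = integral A ?f - integral B ?f"
  proof -
    have "2 * integral (cbox 0 vT) ?f = integral (cbox 0 vT) ?f - integral (cbox (0 + h) (vT + h)) ?f"
      using I2 by simp
    also have "\<dots> = (integral A ?f + integral (cbox h vT) ?f) - (integral (cbox h vT) ?f + integral B ?f)"
      by (simp only: e1 e2)
    finally show ?thesis by simp
  qed
  define P where "P = (\<Prod>j\<in>UNIV - {i}. T)"
  have TP: "T ^ CARD('n) = T * P"
    using prod.remove[of UNIV i "\<lambda>j. T"] by (simp add: P_def)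
  have pr: "(\<Prod>j\<in>UNIV. if j = i then t else T) = t * P"
    using prod.remove[of UNIV i "\<lambda>j. if j = i then t else T"] by (simp add: P_def)
  have cA: "measure lborel A = t * P"
    unfolding A_def using T t0 pr
    by (subst content_cbox_cart) (auto simp: interval_ne_empty_cart)
  have cB: "measure lborel B = t * P"
  proof -
    have "(\<Prod>j\<in>UNIV. (vT + h) $ j - (\<chi> j. if j = i then T else 0) $ j) = t * P"
      unfolding pr[symmetric] by (rule prod.cong) (auto simp: vT_def hj)
    then show ?thesis
      unfolding B_def using T t0
      by (subst content_cbox_cart) (auto simp: interval_ne_empty_cart vT_def hj)
  qed
  have bd: "norm (integral (cbox a b) ?f) \<le> 1 * measure lborel (cbox a b)" for a b
    by (rule has_integral_bound[where f = ?f]) (use int in auto)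
  have "2 * norm (integral (cbox 0 vT) ?f) = norm (integral A ?f - integral B ?f)"
    unfolding two[symmetric] by (simp add: norm_mult)
  also have "\<dots> \<le> norm (integral A ?f) + norm (integral B ?f)" by (rule norm_triangle_ineq4)
  also have "\<dots> \<le> 2 * (t * P)"
    using bd[of 0 "\<chi> j. if j = i then t else T"]
      bd[of "\<chi> j. if j = i then T else 0" "vT + h"] cA cB
    by (simp add: A_def B_def)
  finally have "norm (integral (cbox 0 vT) ?f) \<le> t * P" by simp
  moreover have "P > 0" unfolding P_def using T0 by (intro prod_pos) auto
  ultimately show ?thesis
    using T0 unfolding cube_avg_def vT_def[symmetric] TP by (simp add: field_simps)
qed

lemma expo_avg_tendsto:
  fixes l :: "real^'n"
  shows "(cube_avg (expo l) \<longlongrightarrow> (if l = 0 then 1 else 0)) at_top"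
proof (cases "l = 0")
  case True
  then have "expo l = (\<lambda>x. 1)" by auto
  then have "cube_avg (expo l) T = 1" if "T > 0" for T
    using that by (simp add: cube_avg_def integral_const cube_content scaleR_conv_of_real)
  then have "eventually (\<lambda>T. cube_avg (expo l) T = 1) at_top"
    using eventually_gt_at_top[of 0] by (rule eventually_mono[rotated]) simp
  then show ?thesis using True by (simp add: tendsto_eventually)
next
  case False
  then obtain i where i: "l $ i \<noteq> 0" by (auto simp: vec_eq_iff)
  define t where "t = 1 / (2 * \<bar>l $ i\<bar>)"
  have "(cube_avg (expo l) \<longlongrightarrow> 0) at_top"
  proof (rule Lim_null_comparison)
    show "eventually (\<lambda>T. norm (cube_avg (expo l) T) \<le> t / T) at_top"
      using eventually_ge_at_top[of t] by eventually_elim (rule expo_avg_bound[OF i t_def])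
    show "((\<lambda>T. t / T) \<longlongrightarrow> 0) at_top"
      by (rule tendsto_divide_0[OF tendsto_const]) (simp add: filterlim_at_top_imp_at_infinity filterlim_ident)
  qed
  then show ?thesis using False by simp
qed

lemma trig_polyE:
  assumes "f \<in> trig_poly"
  obtains F c where "finite F" "f = (\<lambda>x. \<Sum>l\<in>F. c l * expo l x)"
  using assms unfolding trig_poly_def by blast

lemma trig_poly_expo: "(\<lambda>x. c * expo l x) \<in> trig_poly"
  unfolding trig_poly_def by (auto intro!: exI[of _ "{l}"] exI[of _ "\<lambda>_. c"])

lemma trig_poly_add:
  assumes "f \<in> trig_poly" "g \<in> trig_poly"
  shows "(\<lambda>x. f x + g x) \<in> trig_poly"
proof -
  obtain F c where F: "finite F" "f = (\<lambda>x. \<Sum>l\<in>F. c l * expo l x)" using assms(1) by (rule trig_polyE)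
  obtain G d where G: "finite G" "g = (\<lambda>x. \<Sum>l\<in>G. d l * expo l x)" using assms(2) by (rule trig_polyE)
  define e where "e l = (if l \<in> F then c l else 0) + (if l \<in> G then d l else 0)" for l
  have "f x + g x = (\<Sum>l\<in>F \<union> G. e l * expo l x)" for x
  proof -
    have "(\<Sum>l\<in>F. c l * expo l x) = (\<Sum>l\<in>F \<union> G. (if l \<in> F then c l else 0) * expo l x)"
      using F G by (intro sum.mono_neutral_cong_left) auto
    moreover have "(\<Sum>l\<in>G. d l * expo l x) = (\<Sum>l\<in>F \<union> G. (if l \<in> G then d l else 0) * expo l x)"
      using F G by (intro sum.mono_neutral_cong_left) auto
    ultimately show ?thesis unfolding F(2) G(2) e_def by (simp add: sum.distrib distrib_right)
  qed
  then show ?thesis using F G unfolding trig_poly_def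
    by (auto intro!: exI[of _ "F \<union> G"] exI[of _ e])
qed

lemma trig_poly_zero: "(\<lambda>x. 0) \<in> trig_poly"
  using trig_poly_expo[of 0 0] by simp

lemma trig_poly_sum:
  assumes "finite F" "\<And>l. l \<in> F \<Longrightarrow> f l \<in> trig_poly"
  shows "(\<lambda>x. \<Sum>l\<in>F. f l x) \<in> trig_poly"
  using assms by (induction F) (auto intro: trig_poly_zero trig_poly_add)

lemma trig_poly_mult:
  assumes "f \<in> trig_poly" "g \<in> trig_poly"
  shows "(\<lambda>x. f x * g x) \<in> trig_poly"
proof -
  obtain F c where F: "finite F" "f = (\<lambda>x. \<Sum>l\<in>F. c l * expo l x)" using assms(1) by (rule trig_polyE)
  obtain G d where G: "finite G" "g = (\<lambda>x. \<Sum>l\<in>G. d l * expo l x)" using assms(2) by (rule trig_polyE)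
  have "(\<lambda>x. f x * g x) = (\<lambda>x. \<Sum>l\<in>F. \<Sum>k\<in>G. (c l * d k) * expo (l + k) x)"
    unfolding F(2) G(2) sum_product expo_mult[symmetric] by (simp add: mult_ac)
  also have "\<dots> \<in> trig_poly"
    using F G by (intro trig_poly_sum trig_poly_expo)
  finally show ?thesis .
qed

lemma trig_poly_cnj:
  assumes "f \<in> trig_poly"
  shows "(\<lambda>x. cnj (f x)) \<in> trig_poly"
proof -
  obtain F c where F: "finite F" "f = (\<lambda>x. \<Sum>l\<in>F. c l * expo l x)" using assms(1) by (rule trig_polyE)
  have "(\<lambda>x. cnj (f x)) = (\<lambda>x. \<Sum>l\<in>F. cnj (c l) * expo (- l) x)"
    unfolding F(2) by (simp add: cnj_expo)
  also have "\<dots> \<in> trig_poly"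
    using F by (intro trig_poly_sum trig_poly_expo)
  finally show ?thesis .
qed

lemma trig_poly_continuous: "f \<in> trig_poly \<Longrightarrow> continuous_on UNIV f"
  by (erule trig_polyE) (auto intro!: continuous_intros)

lemma trig_poly_bounded: "f \<in> trig_poly \<Longrightarrow> bounded (range f)"
proof (erule trig_polyE)
  fix F c assume F: "finite F" "f = (\<lambda>x. \<Sum>l\<in>F. c l * expo l x)"
  have "norm (f x) \<le> (\<Sum>l\<in>F. norm (c l))" for x
    unfolding F(2) by (rule order_trans[OF norm_sum]) (simp add: norm_mult)
  then show "bounded (range f)" unfolding bounded_iff by auto
qed

lemma trig_poly_avg_tendsto:
  fixes f :: "real^'n \<Rightarrow> complex"
  assumes "f \<in> trig_poly"
  shows "\<exists>l. (cube_avg f \<longlongrightarrow> l) at_top"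
proof -
  obtain F c where F: "finite F" "f = (\<lambda>x. \<Sum>l\<in>F. c l * expo l x)" using assms(1) by (rule trig_polyE)
  have "\<exists>z. (cube_avg (\<lambda>x. \<Sum>l\<in>F. c l * expo l x) \<longlongrightarrow> z) at_top"
    using F(1)
  proof (induction F)
    case empty
    have "cube_avg (\<lambda>x::real^'n. 0) = (\<lambda>T. 0)" by (auto simp: cube_avg_def)
    then show ?case by (auto intro!: exI[of _ "0::complex"])
  next
    case (insert k F)
    then obtain z where z: "(cube_avg (\<lambda>x. \<Sum>l\<in>F. c l * expo l x) \<longlongrightarrow> z) at_top" by blast
    have "cube_avg (\<lambda>x. \<Sum>l\<in>insert k F. c l * expo l x) =
        (\<lambda>T. c k * cube_avg (expo k) T + cube_avg (\<lambda>x. \<Sum>l\<in>F. c l * expo l x) T)"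
      using insert(1,2) by (auto simp: cube_avg_add continuous_intros cube_avg_mult)
    then show ?case
      using tendsto_add[OF tendsto_mult[OF tendsto_const[of "c k"] expo_avg_tendsto[of k]] z] by auto
  qed
  then show ?thesis using F by simp
qed

lemma C_apE:
  assumes "f \<in> C_ap"
  obtains p where "\<And>k. p k \<in> trig_poly" "uniform_limit UNIV p f sequentially"
  using assms unfolding C_ap_def by blast

lemma trig_poly_C_ap: "f \<in> trig_poly \<Longrightarrow> f \<in> C_ap"
  unfolding C_ap_def by (auto intro!: exI[of _ "\<lambda>_. f"] uniform_limit_const simp: uniform_limit_iff)

lemma expo_C_ap: "expo l \<in> C_ap"
  using trig_poly_expo[of 1 l] by (auto intro: trig_poly_C_ap)

lemma C_ap_continuous: "f \<in> C_ap \<Longrightarrow> continuous_on UNIV f"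
  by (erule C_apE, rule uniform_limit_theorem[where F = sequentially])
    (auto intro!: always_eventually trig_poly_continuous)

lemma C_ap_bounded: "f \<in> C_ap \<Longrightarrow> bounded (range f)"
proof (erule C_apE)
  fix p assume p: "\<And>k. p k \<in> trig_poly" and u: "uniform_limit UNIV p f sequentially"
  have "eventually (\<lambda>n. \<forall>x\<in>UNIV. dist (p n x) (f x) < 1) sequentially"
    using u unfolding uniform_limit_iff by simp
  then obtain n where n: "\<And>x. dist (p n x) (f x) < 1"
    unfolding eventually_sequentially by auto
  obtain B where B: "\<And>x. norm (p n x) \<le> B"
    using trig_poly_bounded[OF p[of n]] unfolding bounded_iff by auto
  have "norm (f x) \<le> B + 1" for x
    using n[of x] B[of x] norm_triangle_ineq2[of "f x" "p n x"] by (simp add: dist_norm norm_minus_commute)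
  then show "bounded (range f)" unfolding bounded_iff by auto
qed

lemma C_ap_add:
  assumes "f \<in> C_ap" "g \<in> C_ap"
  shows "(\<lambda>x. f x + g x) \<in> C_ap"
proof -
  obtain p where p: "\<And>k. p k \<in> trig_poly" "uniform_limit UNIV p f sequentially" using assms(1) unfolding C_ap_def by blast
  obtain q where q: "\<And>k. q k \<in> trig_poly" "uniform_limit UNIV q g sequentially" using assms(2) unfolding C_ap_def by blast
  show ?thesis unfolding C_ap_def
    using p(1) q(1) uniform_limit_add[OF p(2) q(2)]
    by (auto intro!: exI[of _ "\<lambda>k x. p k x + q k x"] trig_poly_add)
qed

lemma C_ap_mult:
  assumes "f \<in> C_ap" "g \<in> C_ap"
  shows "(\<lambda>x. f x * g x) \<in> C_ap"
proof -
  obtain p where p: "\<And>k. p k \<in> trig_poly" "uniform_limit UNIV p f sequentially" using assms(1) unfolding C_ap_def by blast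
  obtain q where q: "\<And>k. q k \<in> trig_poly" "uniform_limit UNIV q g sequentially" using assms(2) unfolding C_ap_def by blast
  show ?thesis unfolding C_ap_def
    using p(1) q(1) uniform_lim_mult[OF p(2) q(2) C_ap_bounded[OF assms(1)] C_ap_bounded[OF assms(2)]]
    by (auto intro!: exI[of _ "\<lambda>k x. p k x * q k x"] trig_poly_mult)
qed

lemma C_ap_cnj:
  assumes "f \<in> C_ap"
  shows "(\<lambda>x. cnj (f x)) \<in> C_ap"
proof -
  obtain p where p: "\<And>k. p k \<in> trig_poly" "uniform_limit UNIV p f sequentially" using assms(1) unfolding C_ap_def by blast
  show ?thesis unfolding C_ap_def
    using p(1) bounded_linear.uniform_limit[OF bounded_linear_cnj p(2)]
    by (auto intro!: exI[of _ "\<lambda>k x. cnj (p k x)"] trig_poly_cnj)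
qed

lemma C_ap_const: "(\<lambda>x. c) \<in> C_ap"
  using trig_poly_expo[of c 0] by (auto intro: trig_poly_C_ap)

lemma C_ap_scale: "f \<in> C_ap \<Longrightarrow> (\<lambda>x. c * f x) \<in> C_ap"
  by (rule C_ap_mult[OF C_ap_const])

lemma C_ap_diff: "f \<in> C_ap \<Longrightarrow> g \<in> C_ap \<Longrightarrow> (\<lambda>x. f x - g x) \<in> C_ap"
  using C_ap_add[OF _ C_ap_scale[of g "-1"]] by simp

lemma cube_avg_tendsto_mean:
  fixes f :: "real^'n \<Rightarrow> complex"
  assumes f: "f \<in> C_ap"
  shows "(cube_avg f \<longlongrightarrow> mean f) at_top"
proof -
  obtain p where p: "\<And>k. p k \<in> trig_poly" and u: "uniform_limit UNIV p f sequentially"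
    using f unfolding C_ap_def by blast
  obtain m where m: "\<And>k. (cube_avg (p k) \<longlongrightarrow> m k) at_top"
    using trig_poly_avg_tendsto[OF p] by metis
  have close: "\<exists>N. \<forall>k\<ge>N. \<forall>T>0. norm (cube_avg (p k) T - cube_avg f T) \<le> e" if e: "e > 0" for e
  proof -
    obtain N where N: "\<And>k x. k \<ge> N \<Longrightarrow> dist (p k x) (f x) < e"
      using u e unfolding uniform_limit_iff eventually_sequentially by blast
    have "norm (cube_avg (p k) T - cube_avg f T) \<le> e" if "k \<ge> N" "T > 0" for k T
    proof -
      have "norm (cube_avg (\<lambda>x. p k x - f x) T) \<le> e"
        using N[OF \<open>k \<ge> N\<close>] that
        by (intro cube_avg_bound continuous_on_diff trig_poly_continuous[OF p] C_ap_continuous[OF f])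
          (auto simp: dist_norm less_imp_le)
      then show ?thesis
        by (simp add: cube_avg_diff trig_poly_continuous[OF p] C_ap_continuous[OF f])
    qed
    then show ?thesis by blast
  qed
  have "Cauchy m"
  proof (rule metric_CauchyI)
    fix e :: real assume e: "e > 0"
    obtain N where N: "\<And>k T. k \<ge> N \<Longrightarrow> T > 0 \<Longrightarrow> norm (cube_avg (p k) T - cube_avg f T) \<le> e / 3"
      using close[of "e / 3"] e by auto
    have "dist (m j) (m k) < e" if "j \<ge> N" "k \<ge> N" for j k
    proof -
      have "norm (m j - m k) \<le> 2 * e / 3"
      proof (rule tendsto_upperbound[OF tendsto_norm[OF tendsto_diff[OF m m]]])
        show "eventually (\<lambda>T. norm (cube_avg (p j) T - cube_avg (p k) T) \<le> 2 * e / 3) at_top"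
          using eventually_gt_at_top[of 0]
        proof eventually_elim
          case (elim T)
          have "norm (cube_avg (p j) T - cube_avg (p k) T)
              \<le> norm (cube_avg (p j) T - cube_avg f T) + norm (cube_avg (p k) T - cube_avg f T)"
            by (metis norm_triangle_ineq4 diff_diff_eq2 diff_add_cancel add_diff_eq)
          then show ?case using N[OF \<open>j \<ge> N\<close> elim] N[OF \<open>k \<ge> N\<close> elim] by simp
        qed
      qed simp
      then show ?thesis using e by (simp add: dist_norm)
    qed
    then show "\<exists>M. \<forall>j\<ge>M. \<forall>k\<ge>M. dist (m j) (m k) < e" by blast
  qed
  then obtain l where l: "m \<longlonglongrightarrow> l"
    using Cauchy_convergent_iff convergent_def by blast
  have "(cube_avg f \<longlongrightarrow> l) at_top"
  proof (rule tendstoI)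
    fix e :: real assume e: "e > 0"
    obtain N where N: "\<And>k T. k \<ge> N \<Longrightarrow> T > 0 \<Longrightarrow> norm (cube_avg (p k) T - cube_avg f T) \<le> e / 3"
      using close[of "e / 3"] e by auto
    obtain M where M: "\<And>k. k \<ge> M \<Longrightarrow> dist (m k) l < e / 3"
      using metric_LIMSEQ_D[OF l, of "e / 3"] e by auto
    define k where "k = max M N"
    have ev: "eventually (\<lambda>T. dist (cube_avg (p k) T) (m k) < e / 3) at_top"
      using tendstoD[OF m, of "e / 3"] e by simp
    show "eventually (\<lambda>T. dist (cube_avg f T) l < e) at_top"
      using ev eventually_gt_at_top[of 0]
    proof eventually_elim
      case (elim T)
      have "dist (cube_avg (p k) T) (cube_avg f T) \<le> e / 3" using N[of k T] elim by (simp add: dist_norm k_def)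
      moreover have "dist (m k) l < e / 3" using M by (simp add: k_def)
      ultimately show ?case using elim(1)
        dist_triangle[of "cube_avg f T" l "cube_avg (p k) T"] dist_triangle[of "cube_avg (p k) T" l "m k"]
        by (simp add: dist_commute)
    qed
  qed
  then show ?thesis
    unfolding mean_def by (metis tendsto_Lim trivial_limit_at_top_linorder)
qed

lemma mean_unique:
  fixes f :: "real^'n \<Rightarrow> complex"
  shows "(cube_avg f \<longlongrightarrow> l) at_top \<Longrightarrow> mean f = l"
  unfolding mean_def by (metis tendsto_Lim trivial_limit_at_top_linorder)

lemma mean_expo: "mean (expo l) = (if l = 0 then 1 else 0)"
  by (rule mean_unique) (rule expo_avg_tendsto)

lemma mean_add:
  assumes "f \<in> C_ap" "g \<in> C_ap"
  shows "mean (\<lambda>x. f x + g x) = mean f + mean g"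
proof (rule mean_unique)
  have "cube_avg (\<lambda>x. f x + g x) = (\<lambda>T. cube_avg f T + cube_avg g T)"
    using assms by (auto simp: cube_avg_add C_ap_continuous)
  then show "(cube_avg (\<lambda>x. f x + g x) \<longlongrightarrow> mean f + mean g) at_top"
    using assms by (auto intro: tendsto_add cube_avg_tendsto_mean)
qed

lemma mean_scale:
  assumes "f \<in> C_ap"
  shows "mean (\<lambda>x. c * f x) = c * mean f"
proof (rule mean_unique)
  have "cube_avg (\<lambda>x. c * f x) = (\<lambda>T. c * cube_avg f T)"
    by (auto simp: cube_avg_mult)
  then show "(cube_avg (\<lambda>x. c * f x) \<longlongrightarrow> c * mean f) at_top"
    using assms by (auto intro!: tendsto_intros cube_avg_tendsto_mean)
qed

lemma mean_cnj:
  assumes "f \<in> C_ap"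
  shows "mean (\<lambda>x. cnj (f x)) = cnj (mean f)"
proof (rule mean_unique)
  have "cube_avg (\<lambda>x. cnj (f x)) = (\<lambda>T. cnj (cube_avg f T))"
    by (auto simp: cube_avg_cnj)
  then show "(cube_avg (\<lambda>x. cnj (f x)) \<longlongrightarrow> cnj (mean f)) at_top"
    using assms by (auto intro!: tendsto_cnj cube_avg_tendsto_mean)
qed

lemma mean_bound:
  fixes f :: "real^'n \<Rightarrow> complex"
  assumes f: "f \<in> C_ap" and b: "\<And>x. norm (f x) \<le> B"
  shows "norm (mean f) \<le> B"
proof (rule tendsto_upperbound[OF tendsto_norm[OF cube_avg_tendsto_mean[OF f]]])
  show "eventually (\<lambda>T. norm (cube_avg f T) \<le> B) at_top"
    using eventually_gt_at_top[of 0] by eventually_elim (rule cube_avg_bound[OF C_ap_continuous[OF f] b])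
qed simp

lemma mean_nonneg:
  fixes f :: "real^'n \<Rightarrow> complex"
  assumes f: "f \<in> C_ap" and b: "\<And>x. 0 \<le> Re (f x)"
  shows "0 \<le> Re (mean f)"
proof (rule tendsto_lowerbound[OF tendsto_Re[OF cube_avg_tendsto_mean[OF f]]])
  show "eventually (\<lambda>T. 0 \<le> Re (cube_avg f T)) at_top"
    using eventually_gt_at_top[of 0]
  proof eventually_elim
    case (elim T)
    have "f integrable_on cbox 0 (\<chi> i. T)" by (rule continuous_integrable_cube[OF C_ap_continuous[OF f]])
    then have i: "((\<lambda>x. Re (f x)) has_integral Re (integral (cbox 0 (\<chi> i. T)) f)) (cbox 0 (\<chi> i. T))"
      using has_integral_linear[OF integrable_integral bounded_linear_Re] by (fastforce simp: o_def)
    have "0 \<le> Re (integral (cbox 0 (\<chi> i. T)) f)"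
      by (rule has_integral_nonneg[OF i]) (use b in auto)
    then show ?case using elim by (simp add: cube_avg_def)
  qed
qed simp


subsection \<open>The semi-inner product on almost periodic functions\<close>

lemmas C_ap_intros = C_ap_add C_ap_diff C_ap_mult C_ap_cnj C_ap_const

lemma ip_B_add_left:
  assumes "f \<in> C_ap" "g \<in> C_ap" "h \<in> C_ap"
  shows "ip_B (\<lambda>x. f x + g x) h = ip_B f h + ip_B g h"
  unfolding ip_B_def distrib_right using assms by (intro mean_add C_ap_intros)

lemma ip_B_scale_left:
  assumes "f \<in> C_ap" "h \<in> C_ap"
  shows "ip_B (\<lambda>x. c * f x) h = c * ip_B f h"
  unfolding ip_B_def mult.assoc using assms by (intro mean_scale C_ap_intros)

lemma ip_B_cnj:
  assumes "f \<in> C_ap" "h \<in> C_ap"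
  shows "ip_B f h = cnj (ip_B h f)"
  unfolding ip_B_def using mean_cnj[of "\<lambda>x. h x * cnj (f x)"] assms
  by (simp add: C_ap_intros mult.commute)

lemma ip_B_diff_left:
  assumes "f \<in> C_ap" "g \<in> C_ap" "h \<in> C_ap"
  shows "ip_B (\<lambda>x. f x - g x) h = ip_B f h - ip_B g h"
  using ip_B_add_left[of f "\<lambda>x. -1 * g x" h] ip_B_scale_left[of g h "-1"] assms
  by (simp add: C_ap_scale[of g "-1", simplified])

lemma ip_B_scale_right:
  assumes "f \<in> C_ap" "h \<in> C_ap"
  shows "ip_B f (\<lambda>x. c * h x) = cnj c * ip_B f h"
  using assms ip_B_cnj[of f "\<lambda>x. c * h x"] ip_B_scale_left[of h f c] ip_B_cnj[of f h]
  by (simp add: C_ap_scale)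

lemma ip_B_diff_right:
  assumes "f \<in> C_ap" "g \<in> C_ap" "h \<in> C_ap"
  shows "ip_B h (\<lambda>x. f x - g x) = ip_B h f - ip_B h g"
  using assms ip_B_cnj[of h "\<lambda>x. f x - g x"] ip_B_diff_left[of f g h] ip_B_cnj[of h f] ip_B_cnj[of h g]
  by (simp add: C_ap_diff)

lemma ip_B_add_right:
  assumes "f \<in> C_ap" "g \<in> C_ap" "h \<in> C_ap"
  shows "ip_B h (\<lambda>x. f x + g x) = ip_B h f + ip_B h g"
  using assms ip_B_cnj[of h "\<lambda>x. f x + g x"] ip_B_add_left[of f g h] ip_B_cnj[of h f] ip_B_cnj[of h g]
  by (simp add: C_ap_add)

lemma ip_B_self_nonneg: "f \<in> C_ap \<Longrightarrow> 0 \<le> Re (ip_B f f)"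
  unfolding ip_B_def by (intro mean_nonneg C_ap_intros) (auto simp: complex_mult_cnj)

lemma ip_B_self: "f \<in> C_ap \<Longrightarrow> ip_B f f = of_real (Re (ip_B f f))"
  using ip_B_cnj[of f f] by (simp add: complex_eq_iff)

lemma norm_B_nonneg [simp]: "f \<in> C_ap \<Longrightarrow> 0 \<le> norm_B f"
  by (simp add: norm_B_def ip_B_self_nonneg)

lemma norm_B_sq: "f \<in> C_ap \<Longrightarrow> (norm_B f)\<^sup>2 = Re (ip_B f f)"
  by (simp add: norm_B_def ip_B_self_nonneg)

lemma norm_B_scale: "f \<in> C_ap \<Longrightarrow> norm_B (\<lambda>x. c * f x) = norm c * norm_B f"
proof -
  assume f: "f \<in> C_ap"
  have "ip_B (\<lambda>x. c * f x) (\<lambda>x. c * f x) = (c * cnj c) * ip_B f f"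
    using f by (simp add: ip_B_scale_left ip_B_scale_right C_ap_scale mult_ac)
  also have "c * cnj c = of_real ((norm c)\<^sup>2)" by (rule complex_norm_square[symmetric])
  finally show ?thesis by (simp add: norm_B_def real_sqrt_mult)
qed

lemma ip_B_Cauchy_Schwarz:
  assumes f: "f \<in> C_ap" and g: "g \<in> C_ap"
  shows "norm (ip_B f g) \<le> norm_B f * norm_B g"
proof -
  define z where "z = ip_B f g"
  define F where "F = Re (ip_B f f)"
  define G where "G = Re (ip_B g g)"
  define Z where "Z = (norm z)\<^sup>2"
  have nn: "0 \<le> F" "0 \<le> G" "0 \<le> Z"
    using f g by (auto simp: F_def G_def Z_def ip_B_self_nonneg)
  have gf: "ip_B g f = cnj z" using ip_B_cnj[OF g f] by (simp add: z_def)
  have ineq: "0 \<le> F - 2 * s * Z + s\<^sup>2 * Z * G" for s :: real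
  proof -
    define c where "c = of_real s * z"
    have cg: "(\<lambda>x. c * g x) \<in> C_ap" using g by (rule C_ap_scale)
    have zz: "z * cnj z = of_real Z" unfolding Z_def by (rule complex_norm_square[symmetric])
    have gg: "ip_B g g = of_real G" unfolding G_def by (rule ip_B_self[OF g])
    have ff: "ip_B f f = of_real F" unfolding F_def by (rule ip_B_self[OF f])
    have "ip_B (\<lambda>x. f x - c * g x) (\<lambda>x. f x - c * g x)
        = ip_B f f - cnj c * ip_B f g - c * ip_B g f + c * cnj c * ip_B g g"
      using f g cg
      by (simp add: ip_B_diff_left ip_B_diff_right C_ap_diff ip_B_scale_left ip_B_scale_right algebra_simps)
    also have "\<dots> = of_real F - of_real s * (z * cnj z) - of_real s * (z * cnj z)
        + of_real (s\<^sup>2) * (z * cnj z) * of_real G"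
      unfolding ff gf gg c_def z_def[symmetric] by (simp add: power2_eq_square mult_ac)
    also have "\<dots> = of_real (F - 2 * s * Z + s\<^sup>2 * Z * G)"
      unfolding zz by simp
    finally have "Re (ip_B (\<lambda>x. f x - c * g x) (\<lambda>x. f x - c * g x)) = F - 2 * s * Z + s\<^sup>2 * Z * G"
      by simp
    then show ?thesis using ip_B_self_nonneg[OF C_ap_diff[OF f cg]] by simp
  qed
  have "Z \<le> F * G"
  proof (cases "G = 0")
    case True
    have "Z = 0"
    proof (rule ccontr)
      assume "Z \<noteq> 0"
      then show False using ineq[of "(F + 1) / (2 * Z)"] True by (simp add: field_simps)
    qed
    then show ?thesis using nn by simp
  next
    case False
    then show ?thesis using ineq[of "1 / G"] nn by (simp add: field_simps power2_eq_square)
  qed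
  then have "sqrt Z \<le> sqrt F * sqrt G" by (metis real_sqrt_le_iff real_sqrt_mult)
  then show ?thesis by (simp add: Z_def z_def F_def G_def norm_B_def)
qed

lemma norm_B_triangle:
  assumes f: "f \<in> C_ap" and g: "g \<in> C_ap"
  shows "norm_B (\<lambda>x. f x + g x) \<le> norm_B f + norm_B g"
proof (rule power2_le_imp_le)
  have "Re (ip_B (\<lambda>x. f x + g x) (\<lambda>x. f x + g x)) = Re (ip_B f f) + Re (ip_B f g) + Re (ip_B g f) + Re (ip_B g g)"
    using f g by (simp add: ip_B_add_left ip_B_add_right C_ap_add)
  also have "Re (ip_B g f) = Re (ip_B f g)" using ip_B_cnj[OF g f] by simp
  finally have "(norm_B (\<lambda>x. f x + g x))\<^sup>2 = (norm_B f)\<^sup>2 + 2 * Re (ip_B f g) + (norm_B g)\<^sup>2"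
    using f g by (simp add: norm_B_sq C_ap_add)
  also have "Re (ip_B f g) \<le> norm_B f * norm_B g"
    using ip_B_Cauchy_Schwarz[OF f g] complex_Re_le_cmod order_trans by blast
  finally show "(norm_B (\<lambda>x. f x + g x))\<^sup>2 \<le> (norm_B f + norm_B g)\<^sup>2"
    by (simp add: power2_sum)
qed (use f g in simp)

lemma norm_B_zero [simp]: "norm_B (\<lambda>x. 0) = 0"
  using norm_B_scale[OF C_ap_const[of 0], of 0] by simp

lemma norm_B_minus_commute:
  assumes "f \<in> C_ap" "g \<in> C_ap"
  shows "norm_B (\<lambda>x. f x - g x) = norm_B (\<lambda>x. g x - f x)"
  using norm_B_scale[of "\<lambda>x. f x - g x" "-1"] assms by (simp add: C_ap_diff)

lemma norm_B_triangle_diff: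
  assumes "f \<in> C_ap" "g \<in> C_ap" "h \<in> C_ap"
  shows "norm_B (\<lambda>x. f x - h x) \<le> norm_B (\<lambda>x. f x - g x) + norm_B (\<lambda>x. g x - h x)"
  using norm_B_triangle[of "\<lambda>x. f x - g x" "\<lambda>x. g x - h x"] assms by (simp add: C_ap_diff)

lemma norm_B_bound:
  fixes f :: "real^'n \<Rightarrow> complex"
  assumes f: "f \<in> C_ap" and b: "\<And>x. norm (f x) \<le> B"
  shows "norm_B f \<le> B"
proof -
  have B: "0 \<le> B" using b[of 0] norm_ge_zero order_trans by blast
  have "norm (ip_B f f) \<le> B * B"
    unfolding ip_B_def using f b B by (intro mean_bound C_ap_intros) (auto simp: norm_mult intro!: mult_mono)
  then have "Re (ip_B f f) \<le> B\<^sup>2"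
    using complex_Re_le_cmod[of "ip_B f f"] by (simp add: power2_eq_square)
  then show ?thesis unfolding norm_B_def using B real_le_lsqrt by blast
qed

section \<open>The Hilbert space of Besicovitch almost periodic functions\<close>

text \<open>
  \<open>B\<^sup>2\<close> is the completion of \<open>C_ap\<close>: Cauchy sequences modulo sequences tending to 0 in \<open>norm_B\<close>.
\<close>

definition B_Cauchy :: "(nat \<Rightarrow> real^'n \<Rightarrow> complex) \<Rightarrow> bool" where
  "B_Cauchy u \<longleftrightarrow> (\<forall>k. u k \<in> C_ap) \<and>
     (\<forall>e>0. \<exists>N. \<forall>m\<ge>N. \<forall>n\<ge>N. norm_B (\<lambda>x. u m x - u n x) < e)"

definition B_rel :: "(nat \<Rightarrow> real^'n \<Rightarrow> complex) \<Rightarrow> (nat \<Rightarrow> real^'n \<Rightarrow> complex) \<Rightarrow> bool" where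
  "B_rel u v \<longleftrightarrow> B_Cauchy u \<and> B_Cauchy v \<and> (\<lambda>k. norm_B (\<lambda>x. u k x - v k x)) \<longlonglongrightarrow> 0"

lemma B_Cauchy_C_ap: "B_Cauchy u \<Longrightarrow> u k \<in> C_ap"
  by (simp add: B_Cauchy_def)

lemma B_Cauchy_const: "f \<in> C_ap \<Longrightarrow> B_Cauchy (\<lambda>_. f)"
  by (simp add: B_Cauchy_def)

lemma B_rel_refl: "B_Cauchy u \<Longrightarrow> B_rel u u"
  by (simp add: B_rel_def)

lemma B_rel_sym: "B_rel u v \<Longrightarrow> B_rel v u"
  unfolding B_rel_def using norm_B_minus_commute[OF B_Cauchy_C_ap B_Cauchy_C_ap] by fastforce

lemma B_rel_trans: 
  assumes "B_rel u v" "B_rel v w" shows "B_rel u w"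
proof -
  have c: "B_Cauchy u" "B_Cauchy v" "B_Cauchy w"
    and l: "(\<lambda>k. norm_B (\<lambda>x. u k x - v k x)) \<longlonglongrightarrow> 0" "(\<lambda>k. norm_B (\<lambda>x. v k x - w k x)) \<longlonglongrightarrow> 0"
    using assms by (auto simp: B_rel_def)
  have "(\<lambda>k. norm_B (\<lambda>x. u k x - w k x)) \<longlonglongrightarrow> 0"
  proof (rule tendsto_sandwich[OF _ _ tendsto_const])
    show "(\<lambda>k. norm_B (\<lambda>x. u k x - v k x) + norm_B (\<lambda>x. v k x - w k x)) \<longlonglongrightarrow> 0"
      using tendsto_add[OF l] by simp
  qed (use c in \<open>auto intro!: always_eventually norm_B_nonneg C_ap_diff norm_B_triangle_diff c[THEN B_Cauchy_C_ap]\<close>)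
  then show ?thesis using c by (simp add: B_rel_def)
qed

quotient_type (overloaded) 'n B2 = "nat \<Rightarrow> real^'n \<Rightarrow> complex" / partial: B_rel
proof (rule part_equivpI)
  show "\<exists>u. B_rel u u"
    using B_rel_refl[OF B_Cauchy_const[OF C_ap_const]] by blast
  show "symp B_rel" by (rule sympI) (rule B_rel_sym)
  show "transp B_rel" by (rule transpI) (rule B_rel_trans)
qed

definition B2_of :: "(real^'n \<Rightarrow> complex) \<Rightarrow> 'n B2" where
  "B2_of f = abs_B2 (\<lambda>_. f)"

lemma B_Cauchy_add:
  assumes u: "B_Cauchy u" and v: "B_Cauchy v"
  shows "B_Cauchy (\<lambda>k x. u k x + v k x)"
  unfolding B_Cauchy_def
proof (intro conjI allI impI)
  fix e :: real assume "e > 0"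
  then have e: "e / 2 > 0" by simp
  obtain M where M: "\<And>m n. m \<ge> M \<Longrightarrow> n \<ge> M \<Longrightarrow> norm_B (\<lambda>x. u m x - u n x) < e / 2"
    using u e unfolding B_Cauchy_def by meson
  obtain N where N: "\<And>m n. m \<ge> N \<Longrightarrow> n \<ge> N \<Longrightarrow> norm_B (\<lambda>x. v m x - v n x) < e / 2"
    using v e unfolding B_Cauchy_def by meson
  have "norm_B (\<lambda>x. u m x + v m x - (u n x + v n x)) < e" if "m \<ge> max M N" "n \<ge> max M N" for m n
  proof -
    have "norm_B (\<lambda>x. (u m x - u n x) + (v m x - v n x))
        \<le> norm_B (\<lambda>x. u m x - u n x) + norm_B (\<lambda>x. v m x - v n x)"
      using u v by (intro norm_B_triangle C_ap_intros u[THEN B_Cauchy_C_ap] v[THEN B_Cauchy_C_ap])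
    then show ?thesis using M[of m n] N[of m n] that by (simp add: algebra_simps)
  qed
  then show "\<exists>N. \<forall>m\<ge>N. \<forall>n\<ge>N. norm_B (\<lambda>x. u m x + v m x - (u n x + v n x)) < e" by blast
qed (use u v in \<open>auto intro: C_ap_intros u[THEN B_Cauchy_C_ap] v[THEN B_Cauchy_C_ap]\<close>)

lemma B_Cauchy_scale:
  assumes u: "B_Cauchy u"
  shows "B_Cauchy (\<lambda>k x. c * u k x)"
  unfolding B_Cauchy_def
proof (intro conjI allI impI)
  fix e :: real assume "e > 0"
  then have e: "e / (norm c + 1) > 0" by (simp add: add_nonneg_pos)
  obtain N where N: "\<And>m n. m \<ge> N \<Longrightarrow> n \<ge> N \<Longrightarrow> norm_B (\<lambda>x. u m x - u n x) < e / (norm c + 1)"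
    using u e unfolding B_Cauchy_def by meson
  have "norm_B (\<lambda>x. c * u m x - c * u n x) < e" if "m \<ge> N" "n \<ge> N" for m n
  proof -
    have d: "(\<lambda>x. u m x - u n x) \<in> C_ap" using u by (intro C_ap_intros u[THEN B_Cauchy_C_ap])
    have "norm_B (\<lambda>x. c * (u m x - u n x)) = norm c * norm_B (\<lambda>x. u m x - u n x)"
      by (rule norm_B_scale[OF d])
    also have "\<dots> \<le> (norm c + 1) * norm_B (\<lambda>x. u m x - u n x)"
      using d by (intro mult_right_mono) auto
    also have "\<dots> < e"
    proof -
      have "0 < norm c + 1" by (simp add: add_nonneg_pos)
      then show ?thesis using N[OF that] by (simp add: pos_less_divide_eq mult.commute)
    qed
    finally show ?thesis by (simp add: algebra_simps)
  qed
  then show "\<exists>N. \<forall>m\<ge>N. \<forall>n\<ge>N. norm_B (\<lambda>x. c * u m x - c * u n x) < e" by blast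
qed (use u in \<open>auto intro: C_ap_scale u[THEN B_Cauchy_C_ap]\<close>)

lemma B_rel_add:
  assumes "B_rel u u'" "B_rel v v'"
  shows "B_rel (\<lambda>k x. u k x + v k x) (\<lambda>k x. u' k x + v' k x)"
proof -
  have c: "B_Cauchy u" "B_Cauchy u'" "B_Cauchy v" "B_Cauchy v'"
    and l: "(\<lambda>k. norm_B (\<lambda>x. u k x - u' k x)) \<longlonglongrightarrow> 0" "(\<lambda>k. norm_B (\<lambda>x. v k x - v' k x)) \<longlonglongrightarrow> 0"
    using assms by (auto simp: B_rel_def)
  have "(\<lambda>k. norm_B (\<lambda>x. u k x + v k x - (u' k x + v' k x))) \<longlonglongrightarrow> 0"
  proof (rule tendsto_sandwich[OF _ _ tendsto_const])
    show "(\<lambda>k. norm_B (\<lambda>x. u k x - u' k x) + norm_B (\<lambda>x. v k x - v' k x)) \<longlonglongrightarrow> 0"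
      using tendsto_add[OF l] by simp
    have "norm_B (\<lambda>x. (u k x - u' k x) + (v k x - v' k x))
        \<le> norm_B (\<lambda>x. u k x - u' k x) + norm_B (\<lambda>x. v k x - v' k x)" for k
      using c by (intro norm_B_triangle C_ap_intros c[THEN B_Cauchy_C_ap])
    then show "\<forall>\<^sub>F k in sequentially. norm_B (\<lambda>x. u k x + v k x - (u' k x + v' k x))
        \<le> norm_B (\<lambda>x. u k x - u' k x) + norm_B (\<lambda>x. v k x - v' k x)"
      by (simp add: algebra_simps)
  qed (use c in \<open>auto intro!: always_eventually norm_B_nonneg C_ap_intros c[THEN B_Cauchy_C_ap]\<close>)
  then show ?thesis using c by (simp add: B_rel_def B_Cauchy_add)
qed

lemma B_rel_scale:
  assumes "B_rel u u'"
  shows "B_rel (\<lambda>k x. c * u k x) (\<lambda>k x. c * u' k x)"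
proof -
  have c: "B_Cauchy u" "B_Cauchy u'" and l: "(\<lambda>k. norm_B (\<lambda>x. u k x - u' k x)) \<longlonglongrightarrow> 0"
    using assms by (auto simp: B_rel_def)
  have "norm_B (\<lambda>x. c * u k x - c * u' k x) = norm c * norm_B (\<lambda>x. u k x - u' k x)" for k
    unfolding right_diff_distrib[symmetric] using c by (intro norm_B_scale C_ap_intros c[THEN B_Cauchy_C_ap])
  then have "(\<lambda>k. norm_B (\<lambda>x. c * u k x - c * u' k x)) \<longlonglongrightarrow> 0"
    using tendsto_mult[OF tendsto_const[of "norm c"] l] by simp
  then show ?thesis using c by (simp add: B_rel_def B_Cauchy_scale)
qed

lemma B_Cauchy_bounded:
  assumes u: "B_Cauchy u"
  obtains K where "K > 0" "\<And>k. norm_B (u k) \<le> K"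
proof -
  obtain N where N: "\<And>m n. m \<ge> N \<Longrightarrow> n \<ge> N \<Longrightarrow> norm_B (\<lambda>x. u m x - u n x) < 1"
    using u unfolding B_Cauchy_def by (meson zero_less_one)
  define K where "K = norm_B (u N) + 1 + (\<Sum>k<N. norm_B (u k))"
  have nn: "0 \<le> norm_B (u k)" for k using u by (intro norm_B_nonneg u[THEN B_Cauchy_C_ap])
  have s: "0 \<le> (\<Sum>k<N. norm_B (u k))" by (intro sum_nonneg nn)
  have "norm_B (u k) \<le> K" for k
  proof (cases "k < N")
    case True
    then have "norm_B (u k) \<le> (\<Sum>k<N. norm_B (u k))"
      using nn by (intro member_le_sum) auto
    then show ?thesis using nn[of N] by (simp add: K_def)
  next
    case False
    have "norm_B (\<lambda>x. (u k x - u N x) + u N x) \<le> norm_B (\<lambda>x. u k x - u N x) + norm_B (u N)"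
      using u by (intro norm_B_triangle C_ap_intros u[THEN B_Cauchy_C_ap])
    then show ?thesis using N[of k N] False s by (simp add: K_def)
  qed
  moreover have "K > 0" using nn[of N] s by (simp add: K_def)
  ultimately show ?thesis using that by blast
qed

lemma ip_B_diff_bound:
  assumes "f \<in> C_ap" "f' \<in> C_ap" "g \<in> C_ap" "g' \<in> C_ap"
  shows "norm (ip_B f g - ip_B f' g')
    \<le> norm_B (\<lambda>x. f x - f' x) * norm_B g + norm_B f' * norm_B (\<lambda>x. g x - g' x)"
proof -
  have "ip_B f g - ip_B f' g' = ip_B (\<lambda>x. f x - f' x) g + ip_B f' (\<lambda>x. g x - g' x)"
    using assms by (simp add: ip_B_diff_left ip_B_diff_right)
  then show ?thesis
    using norm_triangle_ineq[of "ip_B (\<lambda>x. f x - f' x) g" "ip_B f' (\<lambda>x. g x - g' x)"]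
      ip_B_Cauchy_Schwarz[of "\<lambda>x. f x - f' x" g] ip_B_Cauchy_Schwarz[of f' "\<lambda>x. g x - g' x"] assms
    by (simp add: C_ap_diff)
qed

lemma ip_B_convergent:
  assumes u: "B_Cauchy u" and v: "B_Cauchy v"
  shows "convergent (\<lambda>k. ip_B (u k) (v k))"
proof -
  obtain K where K: "K > 0" "\<And>k. norm_B (u k) \<le> K" using B_Cauchy_bounded[OF u] by blast
  obtain L where L: "L > 0" "\<And>k. norm_B (v k) \<le> L" using B_Cauchy_bounded[OF v] by blast
  have "Cauchy (\<lambda>k. ip_B (u k) (v k))"
  proof (rule metric_CauchyI)
    fix e :: real assume "e > 0"
    then have e: "e / (2 * L) > 0" "e / (2 * K) > 0" using K L by auto
    obtain M where M: "\<And>m n. m \<ge> M \<Longrightarrow> n \<ge> M \<Longrightarrow> norm_B (\<lambda>x. u m x - u n x) < e / (2 * L)"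
      using u e unfolding B_Cauchy_def by meson
    obtain N where N: "\<And>m n. m \<ge> N \<Longrightarrow> n \<ge> N \<Longrightarrow> norm_B (\<lambda>x. v m x - v n x) < e / (2 * K)"
      using v e unfolding B_Cauchy_def by meson
    have "dist (ip_B (u m) (v m)) (ip_B (u n) (v n)) < e" if mn: "m \<ge> max M N" "n \<ge> max M N" for m n
    proof -
      have nn: "0 \<le> norm_B (\<lambda>x. u m x - u n x)" "0 \<le> norm_B (\<lambda>x. v m x - v n x)"
        using u v by (auto intro!: norm_B_nonneg C_ap_intros u[THEN B_Cauchy_C_ap] v[THEN B_Cauchy_C_ap])
      have "dist (ip_B (u m) (v m)) (ip_B (u n) (v n))
          \<le> norm_B (\<lambda>x. u m x - u n x) * norm_B (v m) + norm_B (u n) * norm_B (\<lambda>x. v m x - v n x)"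
        unfolding dist_norm using u v by (intro ip_B_diff_bound u[THEN B_Cauchy_C_ap] v[THEN B_Cauchy_C_ap])
      also have "\<dots> \<le> norm_B (\<lambda>x. u m x - u n x) * L + K * norm_B (\<lambda>x. v m x - v n x)"
        using K L nn by (intro add_mono mult_left_mono mult_right_mono) auto
      also have "\<dots> < e / 2 + e / 2"
        using M[of m n] N[of m n] mn K L by (intro add_strict_mono) (auto simp: field_simps)
      finally show ?thesis by simp
    qed
    then show "\<exists>M. \<forall>m\<ge>M. \<forall>n\<ge>M. dist (ip_B (u m) (v m)) (ip_B (u n) (v n)) < e" by blast
  qed
  then show ?thesis by (simp add: Cauchy_convergent_iff)
qed

lemma ip_B_rel:
  assumes "B_rel u u'" "B_rel v v'"
  shows "lim (\<lambda>k. ip_B (u k) (v k)) = lim (\<lambda>k. ip_B (u' k) (v' k))"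
proof -
  have c: "B_Cauchy u" "B_Cauchy u'" "B_Cauchy v" "B_Cauchy v'"
    and l: "(\<lambda>k. norm_B (\<lambda>x. u k x - u' k x)) \<longlonglongrightarrow> 0" "(\<lambda>k. norm_B (\<lambda>x. v k x - v' k x)) \<longlonglongrightarrow> 0"
    using assms by (auto simp: B_rel_def)
  obtain K where K: "K > 0" "\<And>k. norm_B (u' k) \<le> K" using B_Cauchy_bounded[OF c(2)] by blast
  obtain L where L: "L > 0" "\<And>k. norm_B (v k) \<le> L" using B_Cauchy_bounded[OF c(3)] by blast
  have a: "(\<lambda>k. ip_B (u k) (v k) - ip_B (u' k) (v' k)) \<longlonglongrightarrow> 0"
  proof (rule Lim_null_comparison)
    show "(\<lambda>k. norm_B (\<lambda>x. u k x - u' k x) * L + K * norm_B (\<lambda>x. v k x - v' k x)) \<longlonglongrightarrow> 0"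
      using tendsto_add[OF tendsto_mult[OF l(1) tendsto_const[of L]] tendsto_mult[OF tendsto_const[of K] l(2)]]
      by simp
    have "norm (ip_B (u k) (v k) - ip_B (u' k) (v' k))
        \<le> norm_B (\<lambda>x. u k x - u' k x) * L + K * norm_B (\<lambda>x. v k x - v' k x)" for k
    proof -
      have nn: "0 \<le> norm_B (\<lambda>x. u k x - u' k x)" "0 \<le> norm_B (\<lambda>x. v k x - v' k x)"
        using c by (auto intro!: norm_B_nonneg C_ap_intros c[THEN B_Cauchy_C_ap])
      have "norm (ip_B (u k) (v k) - ip_B (u' k) (v' k))
          \<le> norm_B (\<lambda>x. u k x - u' k x) * norm_B (v k) + norm_B (u' k) * norm_B (\<lambda>x. v k x - v' k x)"
        using c by (intro ip_B_diff_bound c[THEN B_Cauchy_C_ap])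
      also have "\<dots> \<le> norm_B (\<lambda>x. u k x - u' k x) * L + K * norm_B (\<lambda>x. v k x - v' k x)"
        using K L nn by (intro add_mono mult_left_mono mult_right_mono) auto
      finally show ?thesis .
    qed
    then show "\<forall>\<^sub>F k in sequentially. norm (ip_B (u k) (v k) - ip_B (u' k) (v' k))
        \<le> norm_B (\<lambda>x. u k x - u' k x) * L + K * norm_B (\<lambda>x. v k x - v' k x)"
      by simp
  qed
  have b: "(\<lambda>k. ip_B (u' k) (v' k)) \<longlonglongrightarrow> lim (\<lambda>k. ip_B (u' k) (v' k))"
    using ip_B_convergent[OF c(2,4)] by (simp add: convergent_LIMSEQ_iff)
  have "(\<lambda>k. ip_B (u k) (v k)) \<longlonglongrightarrow> lim (\<lambda>k. ip_B (u' k) (v' k))"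
    using tendsto_add[OF a b] by simp
  then show ?thesis by (rule limI)
qed

lift_definition scale_B2 :: "complex \<Rightarrow> ('n::finite) B2 \<Rightarrow> 'n B2" is "\<lambda>c u k x. c * u k x"
  by (rule B_rel_scale)

lift_definition cinner_B2 :: "('n::finite) B2 \<Rightarrow> 'n B2 \<Rightarrow> complex" is "\<lambda>u v. lim (\<lambda>k. ip_B (u k) (v k))"
  by (rule ip_B_rel)

instantiation B2 :: (finite) real_inner
begin

lift_definition zero_B2 :: "'a B2" is "\<lambda>k x. 0"
  by (intro B_rel_refl B_Cauchy_const C_ap_const)

lift_definition plus_B2 :: "'a B2 \<Rightarrow> 'a B2 \<Rightarrow> 'a B2" is "\<lambda>u v k x. u k x + v k x"
  by (rule B_rel_add)

definition uminus_B2 :: "'a B2 \<Rightarrow> 'a B2" where "uminus_B2 u = scale_B2 (- 1) u"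

definition minus_B2 :: "'a B2 \<Rightarrow> 'a B2 \<Rightarrow> 'a B2" where "minus_B2 u v = u + - v" for u v :: "'a B2"

definition scaleR_B2 :: "real \<Rightarrow> 'a B2 \<Rightarrow> 'a B2" where "scaleR_B2 r = scale_B2 (of_real r)"

definition inner_B2 :: "'a B2 \<Rightarrow> 'a B2 \<Rightarrow> real" where "inner_B2 u v = Re (cinner_B2 u v)"

definition norm_B2 :: "'a B2 \<Rightarrow> real" where "norm_B2 u = sqrt (inner u u)" for u :: "'a B2"

definition sgn_B2 :: "'a B2 \<Rightarrow> 'a B2" where "sgn_B2 u = scaleR (inverse (norm u)) u" for u :: "'a B2"

definition dist_B2 :: "'a B2 \<Rightarrow> 'a B2 \<Rightarrow> real" where "dist_B2 u v = norm (u - v)" for u v :: "'a B2"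

definition uniformity_B2 :: "('a B2 \<times> 'a B2) filter" where
  "uniformity_B2 = (INF e\<in>{0<..}. principal {(u, v). dist u v < e})"

definition open_B2 :: "'a B2 set \<Rightarrow> bool" where
  "open_B2 U \<longleftrightarrow> (\<forall>u\<in>U. \<forall>\<^sub>F (u', v) in uniformity. u' = u \<longrightarrow> v \<in> U)" for U :: "'a B2 set"

instance
proof
  have scale: "scale_B2 c (scale_B2 d u) = scale_B2 (c * d) u" for c d and u :: "'a B2"
    by transfer (simp add: mult.assoc B_rel_refl B_rel_def B_Cauchy_scale)
  have one: "scale_B2 1 u = u" for u :: "'a B2"
    by transfer simp
  have sadd: "scale_B2 (c + d) u = scale_B2 c u + scale_B2 d u" for c d and u :: "'a B2"
    by transfer (simp add: distrib_right B_rel_refl B_rel_def B_Cauchy_scale B_Cauchy_add)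
  have addr: "scale_B2 c (u + v) = scale_B2 c u + scale_B2 c v" for c and u v :: "'a B2"
    by transfer (simp add: distrib_left B_rel_refl B_rel_def B_Cauchy_scale B_Cauchy_add)
  have s0: "scale_B2 0 u = 0" for u :: "'a B2"
    by transfer (simp add: B_rel_refl B_rel_def B_Cauchy_const C_ap_const)
  fix u v w :: "'a B2" and r s :: real
  show "u + v + w = u + (v + w)"
    by transfer (simp add: add.assoc B_rel_refl B_rel_def B_Cauchy_add)
  show "u + v = v + u"
    by transfer (simp add: add.commute B_rel_refl B_rel_def B_Cauchy_add)
  show "0 + u = u"
    by transfer simp
  show "- u + u = 0"
    using sadd[of "-1" 1 u] by (simp add: uminus_B2_def one s0)
  show "u - v = u + - v" by (simp add: minus_B2_def)
  show "r *\<^sub>R (u + v) = r *\<^sub>R u + r *\<^sub>R v" by (simp add: scaleR_B2_def addr)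
  show "(r + s) *\<^sub>R u = r *\<^sub>R u + s *\<^sub>R u" by (simp add: scaleR_B2_def sadd)
  show "r *\<^sub>R s *\<^sub>R u = (r * s) *\<^sub>R u" by (simp add: scaleR_B2_def scale)
  show "1 *\<^sub>R u = u" by (simp add: scaleR_B2_def one)
  show "sgn u = inverse (norm u) *\<^sub>R u" by (simp add: sgn_B2_def)
  show "dist u v = norm (u - v)" by (simp add: dist_B2_def)
  show "uniformity = (INF e\<in>{0<..}. principal {(u :: 'a B2, v). dist u v < e})"
    by (simp add: uniformity_B2_def)
  show "open U \<longleftrightarrow> (\<forall>u\<in>U. \<forall>\<^sub>F (u', v) in uniformity. u' = u \<longrightarrow> v \<in> U)" for U :: "'a B2 set"
    by (simp add: open_B2_def)
  show "norm u = sqrt (inner u u)" by (simp add: norm_B2_def)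
  show "inner u v = inner v u"
    unfolding inner_B2_def
  proof transfer
    fix u v :: "nat \<Rightarrow> real^'a \<Rightarrow> complex"
    assume "B_rel u u" "B_rel v v"
    then have c: "B_Cauchy u" "B_Cauchy v" by (auto simp: B_rel_def)
    have "(\<lambda>k. cnj (ip_B (v k) (u k))) \<longlonglongrightarrow> cnj (lim (\<lambda>k. ip_B (v k) (u k)))"
      using ip_B_convergent[OF c(2,1)] by (intro tendsto_cnj) (simp add: convergent_LIMSEQ_iff)
    then have "(\<lambda>k. ip_B (u k) (v k)) \<longlonglongrightarrow> cnj (lim (\<lambda>k. ip_B (v k) (u k)))"
      using ip_B_cnj[OF B_Cauchy_C_ap[OF c(1)] B_Cauchy_C_ap[OF c(2)]] by simp
    then have "lim (\<lambda>k. ip_B (u k) (v k)) = cnj (lim (\<lambda>k. ip_B (v k) (u k)))"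
      by (rule limI)
    then show "Re (lim (\<lambda>k. ip_B (u k) (v k))) = Re (lim (\<lambda>k. ip_B (v k) (u k)))"
      by simp
  qed
  show "inner (u + v) w = inner u w + inner v w"
    unfolding inner_B2_def plus_complex.simps(1)[symmetric]
  proof (rule arg_cong[where f = Re], transfer)
    fix u v w :: "nat \<Rightarrow> real^'a \<Rightarrow> complex"
    assume "B_rel u u" "B_rel v v" "B_rel w w"
    then have c: "B_Cauchy u" "B_Cauchy v" "B_Cauchy w" by (auto simp: B_rel_def)
    have "(\<lambda>k. ip_B (u k) (w k) + ip_B (v k) (w k))
        \<longlonglongrightarrow> lim (\<lambda>k. ip_B (u k) (w k)) + lim (\<lambda>k. ip_B (v k) (w k))"
      using ip_B_convergent[OF c(1,3)] ip_B_convergent[OF c(2,3)]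
      by (intro tendsto_add) (simp_all add: convergent_LIMSEQ_iff)
    then show "lim (\<lambda>k. ip_B (\<lambda>x. u k x + v k x) (w k))
        = lim (\<lambda>k. ip_B (u k) (w k)) + lim (\<lambda>k. ip_B (v k) (w k))"
      using ip_B_add_left[OF B_Cauchy_C_ap[OF c(1)] B_Cauchy_C_ap[OF c(2)] B_Cauchy_C_ap[OF c(3)]]
      by (intro limI) simp
  qed
  have "cinner_B2 (scale_B2 c u) v = c * cinner_B2 u v" for c
  proof transfer
    fix c and u v :: "nat \<Rightarrow> real^'a \<Rightarrow> complex"
    assume "B_rel u u" "B_rel v v"
    then have c: "B_Cauchy u" "B_Cauchy v" by (auto simp: B_rel_def)
    have "(\<lambda>k. c * ip_B (u k) (v k)) \<longlonglongrightarrow> c * lim (\<lambda>k. ip_B (u k) (v k))"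
      using ip_B_convergent[OF c] by (intro tendsto_mult tendsto_const) (simp_all add: convergent_LIMSEQ_iff)
    then show "lim (\<lambda>k. ip_B (\<lambda>x. c * u k x) (v k)) = c * lim (\<lambda>k. ip_B (u k) (v k))"
      using ip_B_scale_left[OF B_Cauchy_C_ap[OF c(1)] B_Cauchy_C_ap[OF c(2)]]
      by (intro limI) simp
  qed
  then show "inner (r *\<^sub>R u) v = r * inner u v"
    by (simp add: inner_B2_def scaleR_B2_def)
  show "0 \<le> inner u u"
    unfolding inner_B2_def
  proof transfer
    fix u :: "nat \<Rightarrow> real^'a \<Rightarrow> complex"
    assume "B_rel u u"
    then have c: "B_Cauchy u" by (auto simp: B_rel_def)
    have "(\<lambda>k. Re (ip_B (u k) (u k))) \<longlonglongrightarrow> Re (lim (\<lambda>k. ip_B (u k) (u k)))"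
      using ip_B_convergent[OF c c] by (intro tendsto_Re) (simp_all add: convergent_LIMSEQ_iff)
    then show "0 \<le> Re (lim (\<lambda>k. ip_B (u k) (u k)))"
      by (rule LIMSEQ_le_const) (auto intro!: ip_B_self_nonneg B_Cauchy_C_ap[OF c])
  qed
  show "inner u u = 0 \<longleftrightarrow> u = 0"
    unfolding inner_B2_def
  proof transfer
    fix u :: "nat \<Rightarrow> real^'a \<Rightarrow> complex"
    assume "B_rel u u"
    then have c: "B_Cauchy u" by (auto simp: B_rel_def)
    have l: "(\<lambda>k. Re (ip_B (u k) (u k))) \<longlonglongrightarrow> Re (lim (\<lambda>k. ip_B (u k) (u k)))"
      using ip_B_convergent[OF c c] by (intro tendsto_Re) (simp_all add: convergent_LIMSEQ_iff)
    have z: "(\<lambda>k. norm_B (u k)) \<longlonglongrightarrow> 0 \<longleftrightarrow> (\<lambda>k. Re (ip_B (u k) (u k))) \<longlonglongrightarrow> 0"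
    proof
      assume "(\<lambda>k. norm_B (u k)) \<longlonglongrightarrow> 0"
      then show "(\<lambda>k. Re (ip_B (u k) (u k))) \<longlonglongrightarrow> 0"
        using tendsto_power[of "\<lambda>k. norm_B (u k)" 0 sequentially 2] norm_B_sq[OF B_Cauchy_C_ap[OF c]] by simp
    next
      assume "(\<lambda>k. Re (ip_B (u k) (u k))) \<longlonglongrightarrow> 0"
      then show "(\<lambda>k. norm_B (u k)) \<longlonglongrightarrow> 0"
        unfolding norm_B_def using tendsto_real_sqrt[of "\<lambda>k. Re (ip_B (u k) (u k))" 0 sequentially] by simp
    qed
    show "Re (lim (\<lambda>k. ip_B (u k) (u k))) = 0 \<longleftrightarrow> B_rel u (\<lambda>k x. 0)"
    proof -
      have "B_rel u (\<lambda>k x. 0) \<longleftrightarrow> (\<lambda>k. norm_B (u k)) \<longlonglongrightarrow> 0"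
        by (simp add: B_rel_def c B_Cauchy_const C_ap_const)
      moreover have "(\<lambda>k. Re (ip_B (u k) (u k))) \<longlonglongrightarrow> 0 \<longleftrightarrow> Re (lim (\<lambda>k. ip_B (u k) (u k))) = 0"
        using l LIMSEQ_unique by metis
      ultimately show ?thesis using z by blast
    qed
  qed
qed

end


lemma vector_space_scale_B2: "vector_space (scale_B2 :: complex \<Rightarrow> ('n::finite) B2 \<Rightarrow> 'n B2)"
proof
  fix c d and u v :: "'n B2"
  show "scale_B2 c (u + v) = scale_B2 c u + scale_B2 c v"
    by transfer (simp add: distrib_left B_rel_def B_Cauchy_scale B_Cauchy_add)
  show "scale_B2 (c + d) u = scale_B2 c u + scale_B2 d u"
    by transfer (simp add: distrib_right B_rel_def B_Cauchy_scale B_Cauchy_add)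
  show "scale_B2 c (scale_B2 d u) = scale_B2 (c * d) u"
    by transfer (simp add: mult.assoc B_rel_def B_Cauchy_scale)
  show "scale_B2 1 u = u"
    by transfer simp
qed

lemma abs_B2_add: "B_Cauchy u \<Longrightarrow> B_Cauchy v \<Longrightarrow> abs_B2 u + abs_B2 v = abs_B2 (\<lambda>k x. u k x + v k x)"
  by (simp add: plus_B2.abs_eq B_rel_refl)

lemma abs_B2_scale: "B_Cauchy u \<Longrightarrow> scale_B2 c (abs_B2 u) = abs_B2 (\<lambda>k x. c * u k x)"
  by (simp add: scale_B2.abs_eq B_rel_refl)

lemma abs_B2_diff:
  assumes "B_Cauchy u" "B_Cauchy v"
  shows "abs_B2 u - abs_B2 v = abs_B2 (\<lambda>k x. u k x - v k x)"
  using abs_B2_add[OF assms(1) B_Cauchy_scale[OF assms(2), of "-1"]] assms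
  by (simp add: minus_B2_def uminus_B2_def abs_B2_scale)

lemma B2_of_add: "f \<in> C_ap \<Longrightarrow> g \<in> C_ap \<Longrightarrow> B2_of (\<lambda>x. f x + g x) = B2_of f + B2_of g"
  by (simp add: B2_of_def abs_B2_add B_Cauchy_const)

lemma B2_of_diff: "f \<in> C_ap \<Longrightarrow> g \<in> C_ap \<Longrightarrow> B2_of (\<lambda>x. f x - g x) = B2_of f - B2_of g"
  by (simp add: B2_of_def abs_B2_diff B_Cauchy_const)

lemma B2_of_scale: "f \<in> C_ap \<Longrightarrow> B2_of (\<lambda>x. c * f x) = scale_B2 c (B2_of f)"
  by (simp add: B2_of_def abs_B2_scale B_Cauchy_const)

lemma cinner_B2_of: "f \<in> C_ap \<Longrightarrow> g \<in> C_ap \<Longrightarrow> cinner_B2 (B2_of f) (B2_of g) = ip_B f g"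
  by (simp add: B2_of_def cinner_B2.abs_eq B_rel_refl B_Cauchy_const)

lemma norm_B2_of: "f \<in> C_ap \<Longrightarrow> norm (B2_of f) = norm_B f"
  by (simp add: norm_B2_def inner_B2_def cinner_B2_of norm_B_def)

lemma norm_abs_B2:
  assumes c: "B_Cauchy u"
  shows "(\<lambda>k. norm_B (u k)) \<longlonglongrightarrow> norm (abs_B2 u)"
proof -
  have "cinner_B2 (abs_B2 u) (abs_B2 u) = lim (\<lambda>k. ip_B (u k) (u k))"
    by (simp add: cinner_B2.abs_eq B_rel_refl c)
  moreover have "(\<lambda>k. sqrt (Re (ip_B (u k) (u k)))) \<longlonglongrightarrow> sqrt (Re (lim (\<lambda>k. ip_B (u k) (u k))))"
    using ip_B_convergent[OF c c] by (intro tendsto_real_sqrt tendsto_Re) (simp add: convergent_LIMSEQ_iff)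
  ultimately show ?thesis by (simp add: norm_B2_def inner_B2_def norm_B_def)
qed

lemma B2_of_tendsto:
  assumes c: "B_Cauchy u"
  shows "(\<lambda>k. B2_of (u k)) \<longlonglongrightarrow> abs_B2 u"
proof (rule metric_LIMSEQ_I)
  fix e :: real assume "e > 0"
  then obtain N where N: "\<And>m n. m \<ge> N \<Longrightarrow> n \<ge> N \<Longrightarrow> norm_B (\<lambda>x. u m x - u n x) < e / 2"
    using c unfolding B_Cauchy_def by (meson half_gt_zero)
  have "dist (B2_of (u n)) (abs_B2 u) < e" if n: "n \<ge> N" for n
  proof -
    have cn: "B_Cauchy (\<lambda>k. u n)" by (rule B_Cauchy_const[OF B_Cauchy_C_ap[OF c]])
    have cd: "B_Cauchy (\<lambda>k x. u n x - u k x)"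
      using B_Cauchy_add[OF cn B_Cauchy_scale[OF c, of "-1"]] by simp
    have "norm (abs_B2 (\<lambda>k x. u n x - u k x)) \<le> e / 2"
      by (rule LIMSEQ_le_const2[OF norm_abs_B2[OF cd]]) (use N n less_imp_le in blast)
    then show ?thesis
      using \<open>e > 0\<close> by (simp add: dist_norm B2_of_def abs_B2_diff[OF cn c])
  qed
  then show "\<exists>N. \<forall>n\<ge>N. dist (B2_of (u n)) (abs_B2 u) < e" by blast
qed

lemma B2_of_C_ap_dense: "closure (B2_of ` C_ap) = (UNIV :: ('n::finite) B2 set)"
proof -
  have "w \<in> closure (B2_of ` C_ap)" for w :: "'n B2"
  proof -
    have "B_rel (rep_B2 w) (rep_B2 w)" by (rule Quotient_rep_reflp[OF Quotient_B2])
    then have c: "B_Cauchy (rep_B2 w)" by (simp add: B_rel_def)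
    have "abs_B2 (rep_B2 w) = w" by (rule Quotient_abs_rep[OF Quotient_B2])
    then show ?thesis
      using B2_of_tendsto[OF c] B_Cauchy_C_ap[OF c] unfolding closure_sequential
      by (intro exI[of _ "\<lambda>k. B2_of (rep_B2 w k)"]) auto
  qed
  then show ?thesis by auto
qed

lemma B2_of_trig_poly_dense: "closure (B2_of ` trig_poly) = (UNIV :: ('n::finite) B2 set)"
proof -
  have "B2_of ` C_ap \<subseteq> closure (B2_of ` trig_poly :: 'n B2 set)"
  proof (rule image_subsetI)
    fix f :: "real^'n \<Rightarrow> complex" assume f: "f \<in> C_ap"
    then obtain p where p: "\<And>k. p k \<in> trig_poly" and u: "uniform_limit UNIV p f sequentially"
      unfolding C_ap_def by blast
    have "(\<lambda>k. B2_of (p k)) \<longlonglongrightarrow> B2_of f"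
    proof (rule metric_LIMSEQ_I)
      fix e :: real assume "e > 0"
      then obtain N where N: "\<And>k x. k \<ge> N \<Longrightarrow> dist (p k x) (f x) < e / 2"
        using u unfolding uniform_limit_iff eventually_sequentially by (meson half_gt_zero UNIV_I)
      have "dist (B2_of (p k)) (B2_of f) < e" if "k \<ge> N" for k
      proof -
        have pk: "p k \<in> C_ap" by (rule trig_poly_C_ap[OF p])
        have "norm_B (\<lambda>x. p k x - f x) \<le> e / 2"
          using N[OF that] by (intro norm_B_bound C_ap_diff pk f) (simp add: dist_norm less_imp_le)
        then show ?thesis
          using \<open>e > 0\<close> by (simp add: dist_norm flip: B2_of_diff[OF pk f] add: norm_B2_of C_ap_diff pk f)
      qed
      then show "\<exists>N. \<forall>k\<ge>N. dist (B2_of (p k)) (B2_of f) < e" by blast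
    qed
    then show "B2_of f \<in> closure (B2_of ` trig_poly)"
      using p unfolding closure_sequential by (intro exI[of _ "\<lambda>k. B2_of (p k)"]) auto
  qed
  then have "closure (B2_of ` C_ap) \<subseteq> closure (B2_of ` trig_poly :: 'n B2 set)"
    by (simp add: closure_minimal)
  then show ?thesis using B2_of_C_ap_dense by auto
qed

instance B2 :: (finite) complete_space
proof
  fix X :: "nat \<Rightarrow> 'a B2" assume X: "Cauchy X"
  have "\<exists>f\<in>C_ap. dist (B2_of f) (X k) < inverse (Suc k)" for k
    using B2_of_C_ap_dense closure_approachable[of "X k" "B2_of ` C_ap"] by auto
  then obtain f where f: "\<And>k. f k \<in> C_ap" and fX: "\<And>k. dist (B2_of (f k)) (X k) < inverse (Suc k)"
    by metis
  have "(\<lambda>k. dist (B2_of (f k)) (X k)) \<longlonglongrightarrow> 0"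
    by (rule tendsto_sandwich[OF _ _ tendsto_const LIMSEQ_inverse_real_of_nat])
      (use fX less_imp_le in \<open>auto intro!: always_eventually\<close>)
  then have d: "(\<lambda>k. B2_of (f k) - X k) \<longlonglongrightarrow> 0"
    by (simp add: dist_norm tendsto_norm_zero_iff)
  have "Cauchy (\<lambda>k. B2_of (f k))"
  proof (rule CauchyI)
    fix e :: real assume "e > 0"
    then have e: "e / 2 > 0" by simp
    obtain M where M: "\<And>m n. m \<ge> M \<Longrightarrow> n \<ge> M \<Longrightarrow> norm (X m - X n) < e / 2"
      using CauchyD[OF X e] by blast
    obtain N where N: "\<And>m n. m \<ge> N \<Longrightarrow> n \<ge> N \<Longrightarrow> norm (B2_of (f m) - X m - (B2_of (f n) - X n)) < e / 2"
      using CauchyD[OF LIMSEQ_imp_Cauchy[OF d] e] by blast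
    have "norm (B2_of (f m) - B2_of (f n)) < e" if "m \<ge> max M N" "n \<ge> max M N" for m n
      using norm_triangle_ineq[of "X m - X n" "B2_of (f m) - X m - (B2_of (f n) - X n)"]
        M[of m n] N[of m n] that by simp
    then show "\<exists>M. \<forall>m\<ge>M. \<forall>n\<ge>M. norm (B2_of (f m) - B2_of (f n)) < e" by blast
  qed
  then have "B_Cauchy f"
    unfolding B_Cauchy_def Cauchy_def using f
    by (auto simp: dist_norm norm_B2_of C_ap_diff simp flip: B2_of_diff)
  from tendsto_diff[OF B2_of_tendsto[OF this] d] have "X \<longlonglongrightarrow> abs_B2 f" by simp
  then show "convergent X" by (auto simp: convergent_def)
qed

section \<open>Symbols\<close>

definition dir_deriv :: "'a::real_normed_vector \<Rightarrow> ('a \<Rightarrow> complex) \<Rightarrow> 'a \<Rightarrow> complex" where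
  "dir_deriv v f x = vector_derivative (\<lambda>t. f (x + t *\<^sub>R v)) (at 0)"

primrec partials :: "'a::real_normed_vector list \<Rightarrow> ('a \<Rightarrow> complex) \<Rightarrow> 'a \<Rightarrow> complex" where
  "partials [] f = f"
| "partials (v # vs) f = dir_deriv v (partials vs f)"

definition smooth :: "('a::euclidean_space \<Rightarrow> complex) \<Rightarrow> bool" where
  "smooth f \<longleftrightarrow> (\<forall>vs. set vs \<subseteq> Basis \<longrightarrow>
     continuous_on UNIV (partials vs f) \<and>
     (\<forall>v\<in>Basis. \<forall>x. (\<lambda>t. partials vs f (x + t *\<^sub>R v)) differentiable (at 0)))"

definition japanese :: "real^'n \<Rightarrow> real" where
  "japanese \<xi> = sqrt (1 + (norm \<xi>)\<^sup>2)"

text \<open>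
  A multi-index is given as the list of the coordinates to differentiate in, each repeated as
  often as its exponent says, so that its order is the length of the list. For smooth symbols the
  order of the list entries does not matter. The first component of a point is \<open>x\<close>, the second
  is \<open>\<xi>\<close>.
\<close>

definition symbol_deriv :: "'n list \<Rightarrow> 'n list \<Rightarrow> ((real^'n) \<times> (real^'n) \<Rightarrow> complex) \<Rightarrow> (real^'n) \<times> (real^'n) \<Rightarrow> complex" where
  "symbol_deriv \<alpha> \<beta> a = partials (map (\<lambda>i. (0, axis i 1)) \<alpha> @ map (\<lambda>i. (axis i 1, 0)) \<beta>) a"

definition APS :: "real \<Rightarrow> real \<Rightarrow> real \<Rightarrow> ((real^'n) \<times> (real^'n) \<Rightarrow> complex) set" where
  "APS m \<rho> \<delta> = {a. smooth a \<and> (\<forall>\<xi>. (\<lambda>x. a (x, \<xi>)) \<in> C_ap) \<and>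
     (\<forall>\<alpha> \<beta>. bdd_above (range (\<lambda>(x, \<xi>).
        japanese \<xi> powr (- m + \<rho> * real (length \<alpha>) - \<delta> * real (length \<beta>))
          * norm (symbol_deriv \<alpha> \<beta> a (x, \<xi>)))))}"

section \<open>Unbounded operators and the essential spectrum\<close>

text \<open>
  An unbounded operator on \<open>H\<close> is represented by its graph, a subset of \<open>H \<times> H\<close>; the closure of
  an operator is the operator whose graph is the closure of its graph in \<open>H \<times> H\<close>. The Fredholm
  property and the essential spectrum are meant for closed operators, as in the case of a closure;
  the definitions themselves do not ask for a closed graph. The type classes provide only real
  scalars, so the complex scalar multiplication \<open>sc\<close> of \<open>H\<close> is a parameter.
\<close>

definition shift_op :: "(complex \<Rightarrow> 'h \<Rightarrow> 'h) \<Rightarrow> ('h \<times> 'h) set \<Rightarrow> complex \<Rightarrow> ('h::ab_group_add \<times> 'h) set" where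
  "shift_op sc T s = {(u, v - sc s u) | u v. (u, v) \<in> T}"

definition op_kernel :: "('h::ab_group_add \<times> 'h) set \<Rightarrow> 'h set" where
  "op_kernel T = {u. (u, 0) \<in> T}"

definition finite_dim :: "(complex \<Rightarrow> 'h \<Rightarrow> 'h) \<Rightarrow> 'h::ab_group_add set \<Rightarrow> bool" where
  "finite_dim sc V \<longleftrightarrow> (\<exists>F. finite F \<and> V \<subseteq> module.span sc F)"

text \<open>The cosets of finitely many vectors span the quotient of the whole space by \<open>V\<close>.\<close>

definition finite_codim :: "(complex \<Rightarrow> 'h \<Rightarrow> 'h) \<Rightarrow> 'h::ab_group_add set \<Rightarrow> bool" where
  "finite_codim sc V \<longleftrightarrow> (\<exists>F. finite F \<and> (\<forall>y. \<exists>z\<in>module.span sc F. y - z \<in> V))"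

definition fredholm :: "(complex \<Rightarrow> 'h \<Rightarrow> 'h) \<Rightarrow> ('h::ab_group_add \<times> 'h) set \<Rightarrow> bool" where
  "fredholm sc T \<longleftrightarrow> finite_dim sc (op_kernel T) \<and> finite_codim sc (Range T)"

definition ess_spectrum :: "(complex \<Rightarrow> 'h \<Rightarrow> 'h) \<Rightarrow> ('h::ab_group_add \<times> 'h) set \<Rightarrow> complex set" where
  "ess_spectrum sc T = {s. \<not> fredholm sc (shift_op sc T s)}"

text \<open>
  The graph in \<open>B\<^sup>2\<close> of the operator \<open>a(x, D)\<close> with domain the trigonometric polynomials, which
  maps \<open>expo l\<close> to \<open>a(\<cdot>, l) expo l\<close>.
\<close>

definition psdo :: "((real^'n) \<times> (real^'n) \<Rightarrow> complex) \<Rightarrow> ('n B2 \<times> 'n B2) set" where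
  "psdo a = {(B2_of (\<lambda>x. \<Sum>l\<in>F. c l * expo l x), B2_of (\<lambda>x. \<Sum>l\<in>F. c l * (a (x, l) * expo l x))) | F c.
     finite F}"

lemma Domain_psdo: "Domain (psdo a) = B2_of ` trig_poly"
  unfolding psdo_def trig_poly_def by auto

lemma ip_B_expo: "ip_B (expo k) (expo l) = (if k = l then 1 else 0)"
  by (simp add: ip_B_def cnj_expo expo_mult mean_expo)

lemma ip_B_trig_poly_expo:
  assumes "finite F"
  shows "ip_B (\<lambda>x. \<Sum>k\<in>F. c k * expo k x) (expo l) = (if l \<in> F then c l else 0)"
  using assms
proof (induction F)
  case empty
  then show ?case using ip_B_scale_left[OF C_ap_const[of 0] expo_C_ap[of l], of 0] by simp
next
  case (insert k F)
  have "(\<lambda>x. \<Sum>k\<in>F. c k * expo k x) \<in> C_ap"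
    using insert(1) by (intro trig_poly_C_ap trig_poly_sum trig_poly_expo)
  then have "ip_B (\<lambda>x. c k * expo k x + (\<Sum>k\<in>F. c k * expo k x)) (expo l)
      = c k * ip_B (expo k) (expo l) + ip_B (\<lambda>x. \<Sum>k\<in>F. c k * expo k x) (expo l)"
    by (simp add: ip_B_add_left ip_B_scale_left expo_C_ap C_ap_scale)
  then show ?case using insert by (auto simp: ip_B_expo)
qed

lemma single_valued_psdo: "single_valued (psdo a)"
proof (rule single_valuedI)
  fix u v w assume uv: "(u, v) \<in> psdo a" and uw: "(u, w) \<in> psdo a"
  obtain F c where F: "finite F" "u = B2_of (\<lambda>x. \<Sum>l\<in>F. c l * expo l x)"
      "v = B2_of (\<lambda>x. \<Sum>l\<in>F. c l * (a (x, l) * expo l x))"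
    using uv unfolding psdo_def by blast
  obtain G d where G: "finite G" "u = B2_of (\<lambda>x. \<Sum>l\<in>G. d l * expo l x)"
      "w = B2_of (\<lambda>x. \<Sum>l\<in>G. d l * (a (x, l) * expo l x))"
    using uw unfolding psdo_def by blast
  have coeff: "(if l \<in> F then c l else 0) = (if l \<in> G then d l else 0)" for l
  proof -
    have C: "(\<lambda>x. \<Sum>k\<in>F. c k * expo k x) \<in> C_ap" "(\<lambda>x. \<Sum>k\<in>G. d k * expo k x) \<in> C_ap"
      by (intro trig_poly_C_ap trig_poly_sum trig_poly_expo F(1) G(1))+
    have "ip_B (\<lambda>x. \<Sum>k\<in>F. c k * expo k x) (expo l) = cinner_B2 u (B2_of (expo l))"
      unfolding F(2) by (rule cinner_B2_of[OF C(1) expo_C_ap, symmetric])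
    also have "\<dots> = ip_B (\<lambda>x. \<Sum>k\<in>G. d k * expo k x) (expo l)"
      unfolding G(2) by (rule cinner_B2_of[OF C(2) expo_C_ap])
    finally show ?thesis using F(1) G(1) by (simp only: ip_B_trig_poly_expo)
  qed
  have "(\<Sum>l\<in>F. c l * (a (x, l) * expo l x)) = (\<Sum>l\<in>G. d l * (a (x, l) * expo l x))" for x
  proof -
    have "(\<Sum>l\<in>F. c l * (a (x, l) * expo l x))
        = (\<Sum>l\<in>F \<union> G. (if l \<in> F then c l else 0) * (a (x, l) * expo l x))"
      using F(1) G(1) by (intro sum.mono_neutral_cong_left) auto
    also have "\<dots> = (\<Sum>l\<in>F \<union> G. (if l \<in> G then d l else 0) * (a (x, l) * expo l x))"
      by (simp only: coeff)
    also have "\<dots> = (\<Sum>l\<in>G. d l * (a (x, l) * expo l x))"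
      using F(1) G(1) by (intro sum.mono_neutral_cong_right) auto
    finally show ?thesis .
  qed
  then show "v = w" using F(3) G(3) by simp
qed

end

theory Submission
  imports Defs
begin

text \<open>
  The exponentials \<open>expo l\<close> are orthonormal for distinct \<open>l\<close>, and \<open>a(x, D) - a(\<cdot>, \<xi>\<^sub>0)\<close> maps \<open>expo l\<close>
  to \<open>(a(\<cdot>, l) - a(\<cdot>, \<xi>\<^sub>0)) expo l\<close>, whose norm tends to 0 as \<open>l\<close> tends to \<open>\<xi>\<^sub>0\<close> because the first
  \<open>\<xi>\<close>-derivatives of \<open>a\<close> are bounded uniformly in \<open>x\<close> and locally in \<open>\<xi>\<close>. So the exponentials at
  distinct frequencies converging to \<open>\<xi>\<^sub>0\<close> form a Weyl sequence. If the closed operator were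
  Fredholm, the open mapping theorem would bring this sequence arbitrarily close to the
  finite-dimensional kernel, which is impossible for an orthonormal sequence.
\<close>

section \<open>Closed linear relations between Banach spaces\<close>

text \<open>Baire category in contrapositive form: if every closure had empty interior, so would
  their countable union, which is the whole space. The sets themselves need not be closed.\<close>

lemma Baire_UN_closure:
  fixes A :: "nat \<Rightarrow> 'a::complete_space set"
  assumes "(\<Union>n. A n) = UNIV"
  obtains n where "interior (closure (A n)) \<noteq> {}"
proof (rule ccontr)
  assume "\<not> thesis"
  with that have "interior (closure (A n)) = {}" for n by blast
  then have "euclidean interior_of (\<Union>n. closure (A n)) = {}"
    by (intro Baire_category_alt disjI1)
      (auto simp: completely_metrizable_space_euclidean interior_of_def interior_def)
  moreover have "(\<Union>n. closure (A n)) = UNIV"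
    using assms closure_subset by (metis (no_types, lifting) UN_mono top.extremum_uniqueI)
  ultimately show False by simp
qed

lemma subspace_closure:
  fixes S :: "'a::real_normed_vector set"
  assumes S: "subspace S"
  shows "subspace (closure S)"
proof (rule subspaceI)
  show "0 \<in> closure S" using subspace_0[OF S] closure_subset by blast
next
  fix x y assume "x \<in> closure S" "y \<in> closure S"
  then obtain f g where "\<And>n. f n \<in> S" "f \<longlonglongrightarrow> x" "\<And>n. g n \<in> S" "g \<longlonglongrightarrow> y"
    unfolding closure_sequential by blast
  then show "x + y \<in> closure S"
    unfolding closure_sequential
    by (intro exI[of _ "\<lambda>n. f n + g n"]) (auto intro: tendsto_add subspace_add[OF S])
next
  fix x and c :: real assume "x \<in> closure S"
  then obtain f where "\<And>n. f n \<in> S" "f \<longlonglongrightarrow> x"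
    unfolding closure_sequential by blast
  then show "c *\<^sub>R x \<in> closure S"
    unfolding closure_sequential
    by (intro exI[of _ "\<lambda>n. c *\<^sub>R f n"]) (auto intro: tendsto_scaleR subspace_scale[OF S])
qed

text \<open>Banach's argument carried out on a graph, so that \<open>T\<close> may be partially
  defined and multivalued. Baire yields approximate solutions with controlled norm. Iterating on the
  remainder sums them to a series, and closedness of \<open>T\<close> makes its sum an exact
  solution.\<close>

theorem closed_relation_open_mapping:
  fixes T :: "('a::banach \<times> 'b::banach) set"
  assumes sub: "subspace T" and cl: "closed T" and surj: "Range T = UNIV"
  obtains C where "C > 0" "\<And>y. \<exists>x. (x, y) \<in> T \<and> norm x \<le> C * norm y"
proof -
  have T0: "(0, 0) \<in> T" using subspace_0[OF sub] by (simp add: zero_prod_def)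
  have Tadd: "(x + x', y + y') \<in> T" if "(x, y) \<in> T" "(x', y') \<in> T" for x x' y y'
    using subspace_add[OF sub that] by simp
  have Tdiff: "(x - x', y - y') \<in> T" if "(x, y) \<in> T" "(x', y') \<in> T" for x x' y y'
    using subspace_diff[OF sub that] by simp
  have Tscale: "(c *\<^sub>R x, c *\<^sub>R y) \<in> T" if "(x, y) \<in> T" for x y c
    using subspace_scale[OF sub that] by simp
  define A where "A n = {y. \<exists>x. (x, y) \<in> T \<and> norm x \<le> real n}" for n
  have "(\<Union>n. A n) = UNIV"
  proof -
    have "\<exists>n. y \<in> A n" for y
    proof -
      obtain x where x: "(x, y) \<in> T" using surj by blast
      moreover obtain n where "norm x \<le> real n" using real_arch_simple by blast
      ultimately show ?thesis unfolding A_def by blast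
    qed
    then show ?thesis by blast
  qed
  then obtain n where "interior (closure (A n)) \<noteq> {}" by (rule Baire_UN_closure)
  then obtain c r where r: "r > 0" and ball: "ball c r \<subseteq> closure (A n)"
    by (metis ex_in_conv mem_interior)
  \<comment> \<open>Two elements of norm at most \<open>n\<close> are subtracted below and the
    difference is divided by \<open>s = r / (2 * d)\<close>; this costs at most
    \<open>M * d\<close>. The summand 1 keeps \<open>M\<close> positive when
    \<open>n = 0\<close>.\<close>
  define M where "M = 4 * (real n + 1) / r"
  have M: "M > 0" using r by (simp add: M_def)
  have approx: "\<exists>x y'. (x, y') \<in> T \<and> norm x \<le> M * d \<and> norm (y - y') \<le> d / 2"
    if y: "norm y \<le> d" and d: "d > 0" for y d
  proof -
    \<comment> \<open>This scale brings \<open>y\<close> to length at most \<open>r / 2\<close>, so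
      that both \<open>c + s *\<^sub>R y\<close> and \<open>c\<close> lie in the ball. Approximating
      both and subtracting removes the unknown centre \<open>c\<close>.\<close>
    define s where "s = r / (2 * d)"
    have s: "s > 0" using r d by (simp add: s_def)
    have "norm (s *\<^sub>R y) \<le> r / 2" using y d r by (simp add: s_def field_simps)
    then have "c + s *\<^sub>R y \<in> closure (A n)" "c \<in> closure (A n)"
      using ball r by (auto simp: dist_norm)
    moreover have "s * d / 4 > 0" using s d by simp
    ultimately obtain p q where p: "p \<in> A n" "dist p (c + s *\<^sub>R y) < s * d / 4"
      and q: "q \<in> A n" "dist q c < s * d / 4"
      unfolding closure_approachable by meson
    obtain x1 where x1: "(x1, p) \<in> T" "norm x1 \<le> n" using p unfolding A_def by blast
    obtain x2 where x2: "(x2, q) \<in> T" "norm x2 \<le> n" using q unfolding A_def by blast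
    have "norm ((1 / s) *\<^sub>R (x1 - x2)) \<le> M * d"
    proof -
      have "norm (x1 - x2) \<le> 2 * (real n + 1)" using x1 x2 norm_triangle_ineq4[of x1 x2] by simp
      also have "\<dots> = M * d * s" using r d by (simp add: M_def s_def field_simps)
      finally show ?thesis using s by (simp add: pos_divide_le_eq flip: scaleR_diff_right)
    qed
    moreover have "norm (y - (1 / s) *\<^sub>R (p - q)) \<le> d / 2"
    proof -
      have "s *\<^sub>R y - (p - q) = (q - c) - (p - (c + s *\<^sub>R y))" by simp
      then have "norm (s *\<^sub>R y - (p - q)) \<le> norm (q - c) + norm (p - (c + s *\<^sub>R y))"
        using norm_triangle_ineq4 by metis
      also have "\<dots> \<le> s * d / 2" using p q by (simp add: dist_norm)
      finally have "norm (s *\<^sub>R y - (p - q)) \<le> s * d / 2" .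
      moreover have "s *\<^sub>R y - (p - q) = s *\<^sub>R (y - (1 / s) *\<^sub>R (p - q))"
        using s by (simp add: algebra_simps)
      ultimately have "s * norm (y - (1 / s) *\<^sub>R (p - q)) \<le> s * (d / 2)"
        using s by (metis abs_of_pos norm_scaleR times_divide_eq_right)
      then show ?thesis using s by simp
    qed
    moreover have "((1 / s) *\<^sub>R (x1 - x2), (1 / s) *\<^sub>R (p - q)) \<in> T"
      by (intro Tscale Tdiff x1 x2)
    ultimately show ?thesis by blast
  qed
  have main: "\<exists>x. (x, y) \<in> T \<and> norm x \<le> 2 * M * norm y" for y
  proof (cases "y = 0")
    case True
    then show ?thesis using T0 by auto
  next
    case False
    define D where "D k = norm y / 2 ^ k" for k :: nat
    have D: "D k > 0" "D (Suc k) = D k / 2" for k using False by (auto simp: D_def)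
    \<comment> \<open>The bound on \<open>z\<close> stands below the existential quantifier so that
      a single choice function \<open>g\<close> serves all \<open>k\<close> and
      \<open>z\<close>.\<close>
    have step: "\<forall>k z. \<exists>xy. norm z \<le> D k \<longrightarrow>
        xy \<in> T \<and> norm (fst xy) \<le> M * D k \<and> norm (z - snd xy) \<le> D (Suc k)"
      using approx[OF _ D(1)] D(2) by (metis fst_conv snd_conv)
    obtain g where g: "\<And>k z. norm z \<le> D k \<Longrightarrow>
        g k z \<in> T \<and> norm (fst (g k z)) \<le> M * D k \<and> norm (z - snd (g k z)) \<le> D (Suc k)"
      using step by metis
    \<comment> \<open>\<open>z k\<close> is the remainder after \<open>k\<close> corrections: the
      partial sum of the \<open>x j\<close> solves for \<open>y - z k\<close>, and each correction
      halves the bound on the remainder.\<close>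
    define z where "z = rec_nat y (\<lambda>k z. z - snd (g k z))"
    have z0: "z 0 = y" and zS: "z (Suc k) = z k - snd (g k (z k))" for k
      by (simp_all add: z_def)
    have zD: "norm (z k) \<le> D k" for k
      by (induction k) (use g in \<open>auto simp: z0 zS D_def\<close>)
    define x where "x k = fst (g k (z k))" for k
    have x: "norm (x k) \<le> (M * norm y) * (1 / 2) ^ k" for k
      using g[OF zD[of k]] by (simp add: x_def D_def power_divide)
    have geo: "(\<lambda>k. (M * norm y) * (1 / 2) ^ k) sums ((M * norm y) * 2)"
      using sums_mult[OF geometric_sums[of "1 / 2 :: real"], of "M * norm y"] by simp
    have sm: "summable x" by (rule summable_comparison_test'[OF sums_summable[OF geo]]) (use x in auto)
    have smn: "summable (\<lambda>k. norm (x k))"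
      by (rule summable_comparison_test'[OF sums_summable[OF geo]]) (use x in auto)
    have part: "(\<Sum>j<k. x j, y - z k) \<in> T" for k
    proof (induction k)
      case 0
      then show ?case using T0 by (simp add: z0)
    next
      case (Suc k)
      have "(x k, snd (g k (z k))) \<in> T" using g[OF zD[of k]] by (simp add: x_def)
      from Tadd[OF Suc this] show ?case by (simp add: zS algebra_simps)
    qed
    have "z \<longlonglongrightarrow> 0"
    proof (rule Lim_null_comparison)
      show "\<forall>\<^sub>F k in sequentially. norm (z k) \<le> D k" using zD by simp
      show "D \<longlonglongrightarrow> 0" unfolding D_def
        using tendsto_mult[OF tendsto_const[of "norm y"] LIMSEQ_power_zero[of "1 / 2 :: real"]]
        by (simp add: power_divide)
    qed
    from tendsto_diff[OF tendsto_const[of y] this] have "(\<lambda>k. y - z k) \<longlonglongrightarrow> y" by simp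
    then have "(\<lambda>k. (\<Sum>j<k. x j, y - z k)) \<longlonglongrightarrow> (suminf x, y)"
      by (intro tendsto_Pair summable_LIMSEQ[OF sm])
    then have "(suminf x, y) \<in> T" by (rule closed_sequentially[OF cl part])
    moreover have "norm (suminf x) \<le> 2 * M * norm y"
    proof -
      have "norm (suminf x) \<le> (\<Sum>k. norm (x k))" by (rule summable_norm[OF smn])
      also have "\<dots> \<le> (\<Sum>k. (M * norm y) * (1 / 2) ^ k)"
        by (rule suminf_le[OF x smn sums_summable[OF geo]])
      also have "\<dots> = (M * norm y) * 2" using geo by (rule sums_unique[symmetric])
      finally show ?thesis by simp
    qed
    ultimately show ?thesis by blast
  qed
  show thesis by (rule that[of "2 * M"]) (use M main in auto)
qed

section \<open>Finite-dimensional subspaces\<close>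

text \<open>Since \<open>K\<close> is closed, \<open>a\<close> has a positive distance
  \<open>d\<close> from it, and this controls the coefficient of \<open>a\<close>: the norm of
  \<open>t *\<^sub>R a + k\<close> is at least \<open>d\<close> times the modulus of
  \<open>t\<close>. Coefficients along a convergent sequence are therefore Cauchy.\<close>

lemma closed_subspace_insert:
  fixes K :: "'a::banach set"
  assumes sub: "subspace K" and cl: "closed K" and a: "a \<notin> K"
  shows "closed {x. \<exists>t::real. x - t *\<^sub>R a \<in> K}"
proof (rule closed_sequential_limits[THEN iffD2], intro allI impI, elim conjE)
  fix x l assume mem: "\<forall>n. x n \<in> {x. \<exists>t. x - t *\<^sub>R a \<in> K}" and lim: "x \<longlonglongrightarrow> l"
  then obtain t where t: "\<And>n. x n - t n *\<^sub>R a \<in> K" by (simp, metis)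
  obtain d where d: "d > 0" and dK: "\<And>k. k \<in> K \<Longrightarrow> d \<le> dist k a"
    using a cl closure_approachable[of a K] by (auto simp: not_less)
  have bound: "\<bar>s\<bar> * d \<le> norm (s *\<^sub>R a + k)" if k: "k \<in> K" for s k
  proof (cases "s = 0")
    case False
    have "d \<le> dist ((- (1 / s)) *\<^sub>R k) a" by (intro dK subspace_scale[OF sub] k)
    also have "\<dots> = norm ((1 / s) *\<^sub>R (s *\<^sub>R a + k))"
      using False by (simp add: dist_norm scaleR_add_right) (metis minus_add_distrib norm_minus_cancel uminus_add_conv_diff)
    also have "\<dots> = norm (s *\<^sub>R a + k) / \<bar>s\<bar>" by simp
    finally show ?thesis using False by (simp add: pos_le_divide_eq mult.commute)
  qed simp
  have "Cauchy t"
  proof (rule metric_CauchyI)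
    fix e :: real assume "e > 0"
    then have "e * d > 0" using d by simp
    then obtain N where N: "\<And>m n. m \<ge> N \<Longrightarrow> n \<ge> N \<Longrightarrow> dist (x m) (x n) < e * d"
      using metric_CauchyD[OF LIMSEQ_imp_Cauchy[OF lim]] by blast
    have "dist (t m) (t n) < e" if "m \<ge> N" "n \<ge> N" for m n
    proof -
      have "\<bar>t m - t n\<bar> * d \<le> norm ((t m - t n) *\<^sub>R a + ((x m - t m *\<^sub>R a) - (x n - t n *\<^sub>R a)))"
        by (intro bound subspace_diff[OF sub] t)
      also have "\<dots> = dist (x m) (x n)" by (simp add: dist_norm algebra_simps)
      also have "\<dots> < e * d" by (rule N[OF that])
      finally show ?thesis using d by (simp add: dist_real_def)
    qed
    then show "\<exists>N. \<forall>m\<ge>N. \<forall>n\<ge>N. dist (t m) (t n) < e" by blast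
  qed
  then obtain s where s: "t \<longlonglongrightarrow> s" using Cauchy_convergent_iff convergent_def by blast
  have "(\<lambda>n. x n - t n *\<^sub>R a) \<longlonglongrightarrow> l - s *\<^sub>R a" by (intro tendsto_intros lim s)
  then have "l - s *\<^sub>R a \<in> K" by (rule closed_sequentially[OF cl t])
  then show "l \<in> {x. \<exists>t. x - t *\<^sub>R a \<in> K}" by blast
qed

lemma closed_span_finite:
  fixes F :: "'a::banach set"
  assumes "finite F"
  shows "closed (span F)"
  using assms
proof (induction F)
  case (insert a F)
  then show ?case
    by (cases "a \<in> span F") (simp_all add: span_redundant, simp add: closed_subspace_insert span_insert)
qed simp

text \<open>Vectors of \<open>F\<close> are processed one at a time; \<open>a\<close> is adjoined to
  \<open>B\<close> only if it is not congruent modulo \<open>R\<close> to a vector of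
  \<open>span B\<close>. The trivial intersection with \<open>R\<close> later ensures that enlarging
  an operator by \<open>B\<close> creates no new kernel.\<close>

lemma finite_codim_complement:
  fixes R :: "'a::real_vector set"
  assumes R: "subspace R" and "finite F" 
  obtains B where "finite B" "span B \<inter> R = {0}"
    "\<And>y z. z \<in> span F \<Longrightarrow> y - z \<in> R \<Longrightarrow> \<exists>b\<in>span B. y - b \<in> R"
proof -
  have "\<exists>B. finite B \<and> span B \<inter> R = {0} \<and> (\<forall>z\<in>span F. \<exists>b\<in>span B. z - b \<in> R)"
    using assms(2)
  proof (induction F)
    case empty
    then show ?case using subspace_0[OF R] by (intro exI[of _ "{}"]) auto
  next
    case (insert a F)
    then obtain B where B: "finite B" "span B \<inter> R = {0}" "\<And>z. z \<in> span F \<Longrightarrow> \<exists>b\<in>span B. z - b \<in> R"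
      by blast
    \<comment> \<open>Serves both cases below: \<open>B'\<close> is \<open>B\<close> when
      \<open>a\<close> is already represented modulo \<open>R\<close>, and \<open>insert a B\<close>
      otherwise.\<close>
    have *: "\<exists>b\<in>span B'. z - b \<in> R"
      if z: "z \<in> span (insert a F)" and B': "span B \<subseteq> span B'" and a: "\<exists>b\<in>span B'. a - b \<in> R" for z B'
    proof -
      obtain t where t: "z - t *\<^sub>R a \<in> span F" using z unfolding span_insert by blast
      obtain b where b: "b \<in> span B'" "z - t *\<^sub>R a - b \<in> R" using B(3)[OF t] B' by blast
      obtain b' where b': "b' \<in> span B'" "a - b' \<in> R" using a by blast
      have "z - t *\<^sub>R a - b + t *\<^sub>R (a - b') \<in> R"
        by (intro subspace_add[OF R] subspace_scale[OF R] b b')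
      then have "z - (b + t *\<^sub>R b') \<in> R" by (simp add: algebra_simps)
      then show ?thesis using b b' by (meson span_add span_scale)
    qed
    show ?case
    proof (cases "\<exists>b\<in>span B. a - b \<in> R")
      case True
      then show ?thesis using B * by blast
    next
      case False
      have "r = 0" if r: "r \<in> span (insert a B)" "r \<in> R" for r
      proof -
        obtain t where t: "r - t *\<^sub>R a \<in> span B" using r unfolding span_insert by blast
        show ?thesis
        proof (cases "t = 0")
          case True
          then show ?thesis using t B(2) r by auto
        next
          case t0: False
          \<comment> \<open>Solving for \<open>a\<close> with nonzero \<open>t\<close> would make
            \<open>a\<close> congruent modulo \<open>R\<close> to a vector of \<open>span B\<close>,
            which this case excludes.\<close>
          have "(1 / t) *\<^sub>R r \<in> R" by (rule subspace_scale[OF R r(2)])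
          moreover have "(1 / t) *\<^sub>R r = a - (- (1 / t)) *\<^sub>R (r - t *\<^sub>R a)"
            using t0 by (simp add: algebra_simps)
          moreover have "(- (1 / t)) *\<^sub>R (r - t *\<^sub>R a) \<in> span B" by (rule span_scale[OF t])
          ultimately show ?thesis using False by metis
        qed
      qed
      then have "span (insert a B) \<inter> R = {0}" using span_zero subspace_0[OF R] by auto
      moreover have "\<exists>b\<in>span (insert a B). a - b \<in> R"
        using subspace_0[OF R] by (intro bexI[of _ a]) (auto intro: span_base)
      ultimately show ?thesis using B(1) *[of _ "insert a B"]
        by (intro exI[of _ "insert a B"]) (auto simp: span_mono subset_insertI)
    qed
  qed
  then obtain B where B: "finite B" "span B \<inter> R = {0}" "\<And>z. z \<in> span F \<Longrightarrow> \<exists>b\<in>span B. z - b \<in> R"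
    by blast
  have "\<exists>b\<in>span B. y - b \<in> R" if z: "z \<in> span F" "y - z \<in> R" for y z
  proof -
    obtain b where b: "b \<in> span B" "z - b \<in> R" using B(3)[OF z(1)] by blast
    have "(y - z) + (z - b) \<in> R" by (rule subspace_add[OF R z(2) b(2)])
    then show ?thesis using b by auto
  qed
  then show thesis using that[OF B(1,2)] by blast
qed

text \<open>A perturbation of \<open>N\<close> orthonormal vectors by less than \<open>1 / N\<close>
  each remains linearly independent, so it cannot fit into the span of fewer than \<open>N\<close>
  vectors.\<close>

lemma orthonormal_near_span_card:
  fixes w p :: "nat \<Rightarrow> 'a::real_inner"
  assumes fin: "finite F" and p: "\<And>i. i < N \<Longrightarrow> p i \<in> span F"
    and w: "\<And>i j. i < N \<Longrightarrow> j < N \<Longrightarrow> w i \<bullet> w j = (if i = j then 1 else 0)"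
    and close: "\<And>i. i < N \<Longrightarrow> norm (w i - p i) * real N < 1"
  shows "N \<le> card F"
proof -
  have zero: "c i = 0" if s: "(\<Sum>i<N. c i *\<^sub>R p i) = 0" and i: "i < N" for c i
  proof -
    \<comment> \<open>The coefficient of largest modulus is tested against \<open>w j\<close>: a
      vanishing combination of the \<open>p i\<close> bounds it by a sum of \<open>N\<close> terms,
      each less than its own \<open>N\<close>-th part if it is nonzero.\<close>
    obtain j where j: "j < N" "\<And>i. i < N \<Longrightarrow> \<bar>c i\<bar> \<le> \<bar>c j\<bar>"
    proof -
      let ?M = "Max ((\<lambda>i. \<bar>c i\<bar>) ` {..<N})"
      have "?M \<in> (\<lambda>i. \<bar>c i\<bar>) ` {..<N}" using i by (intro Max_in) auto
      then obtain j where "j < N" "?M = \<bar>c j\<bar>" by auto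
      then show thesis using that[of j] Max_ge[of "(\<lambda>i. \<bar>c i\<bar>) ` {..<N}"] by auto
    qed
    have wj: "norm (w j) = 1" using w[OF j(1) j(1)] by (simp add: norm_eq_1)
    have "c j = (\<Sum>i<N. c i *\<^sub>R w i) \<bullet> w j"
    proof -
      have "(\<Sum>i<N. c i * (w i \<bullet> w j)) = (\<Sum>i<N. if i = j then c j else 0)"
        by (rule sum.cong) (use w j in auto)
      then show ?thesis using j(1) by (simp add: inner_sum_left)
    qed
    also have "\<dots> = (\<Sum>i<N. c i *\<^sub>R (w i - p i)) \<bullet> w j"
      using s by (simp add: scaleR_diff_right sum_subtractf)
    finally have "\<bar>c j\<bar> \<le> norm (\<Sum>i<N. c i *\<^sub>R (w i - p i))"
      using Cauchy_Schwarz_ineq2[of "\<Sum>i<N. c i *\<^sub>R (w i - p i)" "w j"] wj by simp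
    also have "\<dots> \<le> (\<Sum>i<N. \<bar>c j\<bar> * norm (w i - p i))"
      by (rule sum_norm_le) (use j in \<open>simp add: mult_right_mono\<close>)
    finally have *: "\<bar>c j\<bar> \<le> (\<Sum>i<N. \<bar>c j\<bar> * norm (w i - p i))" .
    have "c j = 0"
    proof (rule ccontr)
      assume cj: "c j \<noteq> 0"
      have "(\<Sum>i<N. \<bar>c j\<bar> * norm (w i - p i)) < (\<Sum>i<N. \<bar>c j\<bar> / real N)"
        by (rule sum_strict_mono) (use i cj close in \<open>auto simp: field_simps\<close>)
      then show False using * i by simp
    qed
    then show ?thesis using j(2)[OF i] by simp
  qed
  \<comment> \<open>Independence concerns the set of values of \<open>p\<close>, so a repeated value
    must be excluded separately; it would give a vanishing combination with coefficients 1 and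
    -1.\<close>
  have inj: "inj_on p {..<N}"
  proof (rule inj_onI, rule ccontr)
    fix i j assume ij: "i \<in> {..<N}" "j \<in> {..<N}" "p i = p j" "i \<noteq> j"
    define c where "c k = (if k = i then 1 else if k = j then - 1 else 0 :: real)" for k
    have "(\<Sum>k<N. c k *\<^sub>R p k) = (\<Sum>k\<in>{i, j}. c k *\<^sub>R p k)"
      using ij by (intro sum.mono_neutral_right) (auto simp: c_def)
    also have "\<dots> = 0" using ij by (simp add: c_def)
    finally have "c i = 0" by (rule zero) (use ij in simp)
    then show False by (simp add: c_def)
  qed
  have "independent (p ` {..<N})"
  proof (rule independent_if_scalars_zero)
    fix f x assume "(\<Sum>x\<in>p ` {..<N}. f x *\<^sub>R x) = 0" "x \<in> p ` {..<N}"
    then show "f x = 0" using zero[of "\<lambda>i. f (p i)"] inj by (auto simp: sum.reindex)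
  qed simp
  then have "card (p ` {..<N}) \<le> card F"
    using independent_span_bound[OF fin, of "p ` {..<N}"] p by (simp add: image_subset_iff)
  then show ?thesis by (simp add: card_image[OF inj])
qed

text \<open>
  After adding a finite-dimensional complement of the range, the open mapping theorem moves each \<open>w k\<close> to within \<open>C * norm (v k)\<close> of the kernel.
\<close>

theorem no_orthonormal_Weyl_sequence:
  fixes T :: "('a::{real_inner, banach} \<times> 'a) set"
  assumes sub: "subspace T" and cl: "closed T"
    and ker: "finite K" "op_kernel T \<subseteq> span K"
    and ran: "finite F" "\<And>y. \<exists>z\<in>span F. y - z \<in> Range T"
    and wv: "\<And>k. (w k, v k) \<in> T" and v: "v \<longlonglongrightarrow> 0"
    and w: "\<And>i j. w i \<bullet> w j = (if i = j then 1 else 0)"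
  shows False
proof -
  have R: "subspace (Range T)"
    using linear_subspace_image[OF bounded_linear.linear[OF bounded_linear_snd] sub] by (simp add: Range_snd)
  obtain B where B: "finite B" "span B \<inter> Range T = {0}"
      and BF: "\<And>y z. z \<in> span F \<Longrightarrow> y - z \<in> Range T \<Longrightarrow> \<exists>b\<in>span B. y - b \<in> Range T"
    using finite_codim_complement[OF R ran(1)] by metis
  \<comment> \<open>The relation \<open>(u, z) \<mapsto> T u + z\<close> with \<open>z\<close> in
    the complement \<open>span B\<close>: it is onto although \<open>T\<close> need not be.\<close>
  define S where "S = {((u, z), y) | u z y. z \<in> span B \<and> (u, y - z) \<in> T}"
  \<comment> \<open>Preimages under continuous linear maps make \<open>S\<close> a closed subspace;
    \<open>span B\<close> is closed because \<open>B\<close> is finite.\<close>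
  have S: "S = (\<lambda>p. snd (fst p)) -` span B \<inter> (\<lambda>p. (fst (fst p), snd p - snd (fst p))) -` T"
    by (auto simp: S_def)
  have "subspace S"
    unfolding S by (intro subspace_inter linear_subspace_vimage sub subspace_span)
      (auto intro!: linearI simp: algebra_simps)
  moreover have "closed S"
    unfolding S by (intro closed_Int closed_vimage closed_span_finite B cl continuous_intros)
  moreover have "Range S = UNIV"
  proof -
    have "\<exists>u z. ((u, z), y) \<in> S" for y
      proof -
        obtain z where "z \<in> span F" "y - z \<in> Range T" using ran(2)[of y] by blast
        then obtain b u where "b \<in> span B" "(u, y - b) \<in> T" using BF by blast
        then show ?thesis by (auto simp: S_def)
      qed
    then show ?thesis by blast
  qed
  ultimately obtain C where C: "C > 0" "\<And>y. \<exists>x. (x, y) \<in> S \<and> norm x \<le> C * norm y"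
    using closed_relation_open_mapping[of S] by metis
  have near: "\<exists>p\<in>span K. norm (w k - p) \<le> C * norm (v k)" for k
  proof -
    obtain u z where uz: "z \<in> span B" "(u, v k - z) \<in> T" "norm (u, z) \<le> C * norm (v k)"
      using C(2)[of "v k"] unfolding S_def by blast
    \<comment> \<open>Subtracting the solution from \<open>(w k, v k)\<close> leaves
      \<open>z\<close> as an element of the range as well as of \<open>span B\<close>; hence
      \<open>z = 0\<close> and \<open>w k - u\<close> lies in the kernel.\<close>
    have "(w k - u, v k - (v k - z)) \<in> T" using subspace_diff[OF sub wv[of k] uz(2)] by simp
    then have k: "(w k - u, z) \<in> T" by simp
    then have "z = 0" using B(2) uz(1) by blast
    then have "w k - u \<in> span K" using k ker(2) by (auto simp: op_kernel_def)
    moreover have "norm u \<le> C * norm (v k)" using norm_fst_le[of u z] uz(3) by simp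
    ultimately show ?thesis by (intro bexI[of _ "w k - u"]) auto
  qed
  then obtain p where p: "\<And>k. p k \<in> span K" "\<And>k. norm (w k - p k) \<le> C * norm (v k)" by metis
  \<comment> \<open>One vector more than the spanning set of the kernel allows. They are taken from
    the tail beyond \<open>k0\<close>, where each is closer than \<open>1 / N\<close> to the
    kernel.\<close>
  define N where "N = Suc (card K)"
  have CN: "C * real N > 0" using C by (simp add: N_def)
  then obtain k0 where k0: "\<And>k. k \<ge> k0 \<Longrightarrow> norm (v k) < 1 / (C * real N)"
    using LIMSEQ_D[OF v, of "1 / (C * real N)"] CN by auto
  have "N \<le> card K"
  proof (rule orthonormal_near_span_card[OF ker(1)])
    fix i assume "i < N"
    have "norm (w (k0 + i) - p (k0 + i)) * real N \<le> C * norm (v (k0 + i)) * real N"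
      by (intro mult_right_mono p) simp
    also have "\<dots> < 1" using k0[of "k0 + i"] CN by (simp add: pos_less_divide_eq mult_ac)
    finally show "norm (w (k0 + i) - p (k0 + i)) * real N < 1" .
  qed (use p w in auto)
  then show False by (simp add: N_def)
qed

section \<open>Besicovitch space as a complex Hilbert space\<close>

instance B2 :: (finite) banach ..

lemma B2_cases_Cauchy:
  fixes u :: "('n::finite) B2"
  obtains r where "B_Cauchy r" "u = abs_B2 r"
  using Quotient_rep_reflp[OF Quotient_B2, of u] Quotient_abs_rep[OF Quotient_B2, of u]
  by (metis B_rel_def)

lemma norm_scale_B2: "norm (scale_B2 c u) = norm c * norm u"
proof -
  obtain r where r: "B_Cauchy r" "u = abs_B2 r" by (rule B2_cases_Cauchy)
  have "(\<lambda>k. norm_B (\<lambda>x. c * r k x)) \<longlonglongrightarrow> norm (scale_B2 c u)"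
    using norm_abs_B2[OF B_Cauchy_scale[OF r(1)]] by (simp add: r abs_B2_scale)
  moreover have "(\<lambda>k. norm_B (\<lambda>x. c * r k x)) \<longlonglongrightarrow> norm c * norm u"
    using tendsto_mult[OF tendsto_const norm_abs_B2[OF r(1)]]
    by (simp add: r norm_B_scale B_Cauchy_C_ap)
  ultimately show ?thesis by (rule LIMSEQ_unique)
qed

lemma bounded_linear_scale_B2: "bounded_linear (scale_B2 c)"
proof -
  interpret vector_space "scale_B2 :: complex \<Rightarrow> 'a B2 \<Rightarrow> 'a B2"
    by (rule vector_space_scale_B2)
  show ?thesis
    by (rule bounded_linear_intro[where K = "norm c"])
      (simp_all add: scale_right_distrib scaleR_B2_def mult.commute norm_scale_B2)
qed

text \<open>Passes from the complex spans in the Fredholm property to the real spans of the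
  preceding theory. Doubling the generators is harmless, since only finiteness matters.\<close>

lemma complex_span_subset_real_span:
  fixes F :: "('n::finite) B2 set"
  shows "module.span scale_B2 F \<subseteq> span (F \<union> scale_B2 \<i> ` F)"
proof -
  interpret B2: vector_space "scale_B2 :: complex \<Rightarrow> 'n B2 \<Rightarrow> 'n B2"
    by (rule vector_space_scale_B2)
  let ?V = "span (F \<union> scale_B2 \<i> ` F)"
  have split: "scale_B2 c u = Re c *\<^sub>R u + Im c *\<^sub>R scale_B2 \<i> u" for c and u :: "'n B2"
  proof -
    have "scale_B2 c u = scale_B2 (of_real (Re c) + of_real (Im c) * \<i>) u"
      by (subst complex_eq) (simp add: mult.commute)
    then show ?thesis by (simp add: B2.scale_left_distrib scaleR_B2_def)
  qed
  \<comment> \<open>Multiplication by \<open>\<i>\<close> permutes the generators up to sign, as it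
    sends \<open>scale_B2 \<i> f\<close> to \<open>- f\<close>.\<close>
  have i: "scale_B2 \<i> u \<in> ?V" if "u \<in> ?V" for u
    using that
  proof (induction rule: span_induct)
    case base
    show ?case
      by (intro linear_subspace_vimage[unfolded vimage_def]
        bounded_linear.linear bounded_linear_scale_B2 subspace_span)
  next
    case (step u)
    then show ?case
    proof
      assume "u \<in> F"
      then show ?thesis by (intro span_base) blast
    next
      assume "u \<in> scale_B2 \<i> ` F"
      then obtain f where f: "f \<in> F" "u = scale_B2 \<i> f" by blast
      then have "scale_B2 \<i> u = (- 1) *\<^sub>R f" by (simp add: scaleR_B2_def)
      then show ?thesis using f by (metis UnI1 span_base span_scale)
    qed
  qed
  have "scale_B2 c u \<in> ?V" if "u \<in> ?V" for c u
    unfolding split[of c u] by (intro span_add span_scale i that)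
  then show ?thesis
    by (intro B2.span_minimal) (auto simp: B2.subspace_def span_zero span_add intro: span_base)
qed

theorem not_fredholm_B2_Weyl:
  fixes T :: "(('n::finite) B2 \<times> 'n B2) set"
  assumes "subspace T" "closed T"
    and "\<And>k. (w k, v k) \<in> T" and "v \<longlonglongrightarrow> 0"
    and "\<And>i j. w i \<bullet> w j = (if i = j then 1 else 0)"
  shows "\<not> fredholm scale_B2 T"
proof
  assume "fredholm scale_B2 T"
  then obtain K F where K: "finite K" "op_kernel T \<subseteq> module.span scale_B2 K"
    and F: "finite F" "\<And>y. \<exists>z\<in>module.span scale_B2 F. y - z \<in> Range T"
    unfolding fredholm_def finite_dim_def finite_codim_def by blast
  show False
  proof (rule no_orthonormal_Weyl_sequence[OF assms(1,2) _ _ _ _ assms(3-5)])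
    show "op_kernel T \<subseteq> span (K \<union> scale_B2 \<i> ` K)"
      using K(2) complex_span_subset_real_span by blast
    show "\<exists>z\<in>span (F \<union> scale_B2 \<i> ` F). y - z \<in> Range T" for y
      using F(2)[of y] complex_span_subset_real_span by blast
  qed (use K F in auto)
qed

lemma inner_expo_B2: "B2_of (expo k) \<bullet> B2_of (expo l) = (if k = l then 1 else 0)"
  by (simp add: inner_B2_def cinner_B2_of expo_C_ap ip_B_expo)

section \<open>Closures of pseudodifferential operators\<close>

text \<open>Both claims go through one induction because additivity of \<open>B2_of\<close> is
  available only on \<open>C_ap\<close>.\<close>

lemma B2_of_sum:
  assumes "finite F" "\<And>l. l \<in> F \<Longrightarrow> f l \<in> C_ap"
  shows "(\<lambda>x. \<Sum>l\<in>F. c l * f l x) \<in> C_ap \<and>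
    B2_of (\<lambda>x. \<Sum>l\<in>F. c l * f l x) = (\<Sum>l\<in>F. scale_B2 (c l) (B2_of (f l)))"
  using assms
proof (induction F)
  case empty
  then show ?case
    by (simp add: C_ap_const) (simp add: B2_of_def zero_B2_def)
next
  case (insert l F)
  then show ?case by (simp add: C_ap_add C_ap_scale B2_of_add B2_of_scale)
qed

text \<open>Once both components are combinations in the Hilbert space with the same coefficients,
  linearity of the graph is a matter of coefficients alone.\<close>

lemma psdo_eq:
  assumes a: "\<And>l. (\<lambda>x. a (x, l)) \<in> C_ap"
  shows "psdo a = {(\<Sum>l\<in>F. scale_B2 (c l) (B2_of (expo l)),
    \<Sum>l\<in>F. scale_B2 (c l) (B2_of (\<lambda>x. a (x, l) * expo l x))) | F c. finite F}"
proof -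
  have "(\<lambda>x. a (x, l) * expo l x) \<in> C_ap" for l by (intro C_ap_mult a expo_C_ap)
  then show ?thesis
    unfolding psdo_def using B2_of_sum[of _ expo] B2_of_sum[of _ "\<lambda>l x. a (x, l) * expo l x"]
    by (intro Collect_cong ex_cong1) (auto simp: expo_C_ap)
qed

lemma subspace_psdo:
  assumes a: "\<And>l. (\<lambda>x. a (x, l)) \<in> C_ap"
  shows "subspace (psdo a)"
proof -
  interpret B2: vector_space "scale_B2 :: complex \<Rightarrow> 'a B2 \<Rightarrow> 'a B2"
    by (rule vector_space_scale_B2)
  define E where "E l = B2_of (expo l)" for l :: "real^'a"
  define A where "A l = B2_of (\<lambda>x. a (x, l) * expo l x)" for l
  have eq: "psdo a = {(\<Sum>l\<in>F. scale_B2 (c l) (E l), \<Sum>l\<in>F. scale_B2 (c l) (A l)) | F c. finite F}"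
    unfolding E_def A_def by (rule psdo_eq[OF a])
  show ?thesis
  proof (rule subspaceI)
    show "0 \<in> psdo a" unfolding eq zero_prod_def by (auto intro!: exI[of _ "{}"])
  next
    fix p q assume "p \<in> psdo a" "q \<in> psdo a"
    then obtain F c G d where F: "finite F"
        "p = (\<Sum>l\<in>F. scale_B2 (c l) (E l), \<Sum>l\<in>F. scale_B2 (c l) (A l))"
      and G: "finite G" "q = (\<Sum>l\<in>G. scale_B2 (d l) (E l), \<Sum>l\<in>G. scale_B2 (d l) (A l))"
      unfolding eq by blast
    \<comment> \<open>Coefficients are extended by zero to the union of the two frequency sets;
      frequencies common to both receive the sum.\<close>
    define e where "e l = (if l \<in> F then c l else 0) + (if l \<in> G then d l else 0)" for l
    have sum: "(\<Sum>l\<in>F. scale_B2 (c l) (X l)) + (\<Sum>l\<in>G. scale_B2 (d l) (X l))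
        = (\<Sum>l\<in>F \<union> G. scale_B2 (e l) (X l))" for X :: "real^'a \<Rightarrow> 'a B2"
    proof -
      have "(\<Sum>l\<in>F. scale_B2 (c l) (X l)) = (\<Sum>l\<in>F \<union> G. scale_B2 (if l \<in> F then c l else 0) (X l))"
        using F G by (intro sum.mono_neutral_cong_left) auto
      moreover have "(\<Sum>l\<in>G. scale_B2 (d l) (X l)) = (\<Sum>l\<in>F \<union> G. scale_B2 (if l \<in> G then d l else 0) (X l))"
        using F G by (intro sum.mono_neutral_cong_left) auto
      ultimately show ?thesis by (simp only: e_def B2.scale_left_distrib sum.distrib)
    qed
    have "p + q = (\<Sum>l\<in>F \<union> G. scale_B2 (e l) (E l), \<Sum>l\<in>F \<union> G. scale_B2 (e l) (A l))"
      by (simp only: F(2) G(2) add_Pair sum)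
    then show "p + q \<in> psdo a"
      unfolding eq using F(1) G(1) by blast
  next
    fix r :: real and p assume "p \<in> psdo a"
    then obtain F c where F: "finite F"
        "p = (\<Sum>l\<in>F. scale_B2 (c l) (E l), \<Sum>l\<in>F. scale_B2 (c l) (A l))"
      unfolding eq by blast
    have "r *\<^sub>R p = (\<Sum>l\<in>F. scale_B2 (of_real r * c l) (E l), \<Sum>l\<in>F. scale_B2 (of_real r * c l) (A l))"
      by (simp add: F(2) scaleR_sum_right) (simp add: scaleR_B2_def)
    then show "r *\<^sub>R p \<in> psdo a"
      unfolding eq using F(1) by (intro CollectI exI conjI)
  qed
qed

text \<open>As a preimage under a continuous linear map, the shifted graph inherits linearity and
  closedness from the original one.\<close>

lemma shift_op_eq_vimage: "shift_op sc T s = (\<lambda>p. (fst p, snd p + sc s (fst p))) -` T"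
proof -
  have "(u, v) \<in> shift_op sc T s \<longleftrightarrow> (u, v + sc s u) \<in> T" for u v
    unfolding shift_op_def by (simp, metis add_diff_cancel_right' diff_add_cancel)
  then show ?thesis by auto
qed

text \<open>The mean value inequality along one frequency axis. The constant may depend on
  \<open>\<xi>\<close> and \<open>i\<close> but not on \<open>x\<close>, which is what a bound in
  the mean-square norm via the supremum requires.\<close>

lemma symbol_Lipschitz_direction:
  fixes a :: "(real^'n) \<times> (real^'n) \<Rightarrow> complex"
  assumes a: "a \<in> APS m \<rho> \<delta>"
  obtains L where "\<And>x t. 0 \<le> t \<Longrightarrow> t \<le> 1 \<Longrightarrow>
    norm (a (x, \<xi> + t *\<^sub>R axis i 1) - a (x, \<xi>)) \<le> L * t"
proof -
  define e :: "real^'n" where "e = axis i 1"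
  define D where "D = dir_deriv (0 :: real^'n, e) a"
  have smooth: "smooth a" using a by (simp add: APS_def)
  have "bdd_above (range (\<lambda>(x, \<eta>). japanese \<eta> powr (- m + \<rho>) * norm (D (x, \<eta>))))"
  proof -
    have "bdd_above (range (\<lambda>(x, \<eta>). japanese \<eta> powr
        (- m + \<rho> * real (length \<alpha>) - \<delta> * real (length \<beta>))
          * norm (symbol_deriv \<alpha> \<beta> a (x, \<eta>))))" for \<alpha> \<beta>
      using a unfolding APS_def by simp
    from this[of "[i]" "[]"] show ?thesis by (simp add: symbol_deriv_def D_def e_def)
  qed
  then obtain C where C: "\<And>x \<eta>. japanese \<eta> powr (- m + \<rho>) * norm (D (x, \<eta>)) \<le> C"
    unfolding bdd_above_def by auto
  \<comment> \<open>The reciprocal of the weight in the symbol estimate for one frequency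
    derivative; it is bounded on the segment by compactness.\<close>
  define g where "g t = japanese (\<xi> + t *\<^sub>R e) powr (m - \<rho>)" for t
  have pos: "japanese \<eta> > 0" for \<eta> :: "real^'n"
    unfolding japanese_def by (simp add: add_pos_nonneg)
  have "continuous_on {0..1} g"
    unfolding g_def japanese_def
    by (intro continuous_intros) (simp add: add_pos_nonneg less_imp_neq[symmetric])
  then have "bdd_above (g ` {0..1})"
    by (intro bounded_imp_bdd_above compact_imp_bounded compact_continuous_image) auto
  then obtain B where B: "\<And>t. t \<in> {0..1} \<Longrightarrow> g t \<le> B"
    unfolding bdd_above_def by (metis imageI)
  have C0: "C \<ge> 0" using order_trans[OF _ C[of \<xi> 0]] by simp
  have D: "norm (D (x, \<xi> + t *\<^sub>R e)) \<le> C * B" if "t \<in> {0..1}" for x t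
  proof -
    have "g t * japanese (\<xi> + t *\<^sub>R e) powr (- m + \<rho>) = 1"
      using pos[of "\<xi> + t *\<^sub>R e"] by (simp add: g_def flip: powr_add)
    then have "norm (D (x, \<xi> + t *\<^sub>R e))
        = g t * (japanese (\<xi> + t *\<^sub>R e) powr (- m + \<rho>) * norm (D (x, \<xi> + t *\<^sub>R e)))"
      by (simp flip: mult.assoc)
    also have "\<dots> \<le> B * C"
    proof (rule mult_mono)
      have "0 \<le> g t" by (simp add: g_def)
      then show "0 \<le> B" using B[OF that] by linarith
    qed (use B[OF that] C in auto)
    finally show ?thesis by (simp add: mult.commute)
  qed
  have deriv: "((\<lambda>t. a (x, \<xi> + t *\<^sub>R e)) has_vector_derivative D (x, \<xi> + t *\<^sub>R e)) (at t)" for x t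
  proof -
    have "(0, e) \<in> Basis" by (simp add: e_def Basis_prod_def)
    then have "(\<lambda>h. partials [] a ((x, \<xi> + t *\<^sub>R e) + h *\<^sub>R (0, e))) differentiable (at 0)"
      using smooth unfolding smooth_def by (metis empty_set empty_subsetI)
    \<comment> \<open>The base point 0 is written \<open>t - t\<close> to fit the chain rule with
      the translation \<open>s - t\<close>, which carries the derivative at 0 over to
      \<open>t\<close>.\<close>
    then have "((\<lambda>h. a ((x, \<xi> + t *\<^sub>R e) + h *\<^sub>R (0, e))) has_vector_derivative D (x, \<xi> + t *\<^sub>R e)) (at (t - t))"
      unfolding D_def dir_deriv_def by (simp add: vector_derivative_works)
    then have "((\<lambda>h. a ((x, \<xi> + t *\<^sub>R e) + h *\<^sub>R (0, e))) \<circ> (\<lambda>s. s - t) has_vector_derivative 1 *\<^sub>R D (x, \<xi> + t *\<^sub>R e)) (at t)"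
      by (intro vector_diff_chain_at) (auto intro!: derivative_eq_intros)
    then show ?thesis by (simp add: o_def algebra_simps)
  qed
  show thesis
  proof (rule that[of "C * B"], fold e_def)
    fix x :: "real^'n" and t :: real assume t: "0 \<le> t" "t \<le> 1"
    have "norm (a (x, \<xi> + t *\<^sub>R e) - a (x, \<xi> + 0 *\<^sub>R e)) \<le> (C * B) * norm (t - 0)"
    proof (rule differentiable_bound[where S = "{0..1}"])
      fix s :: real assume s: "s \<in> {0..1}"
      show "((\<lambda>t. a (x, \<xi> + t *\<^sub>R e)) has_derivative (\<lambda>h. h *\<^sub>R D (x, \<xi> + s *\<^sub>R e))) (at s within {0..1})"
        using deriv[of x s] by (simp add: has_vector_derivative_def has_derivative_at_withinI)
      show "onorm (\<lambda>h. h *\<^sub>R D (x, \<xi> + s *\<^sub>R e)) \<le> C * B"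
        using mult_left_mono[OF D[OF s, of x] abs_ge_zero] by (intro onorm_le) (simp add: mult_ac)
    qed (use t in auto)
    then show "norm (a (x, \<xi> + t *\<^sub>R e) - a (x, \<xi>)) \<le> C * B * t" using t by simp
  qed
qed

theorem proposition6p10:
  fixes a :: "(real^'n) \<times> (real^'n) \<Rightarrow> complex"
    and m \<rho> \<delta> :: real
    and \<xi>\<^sub>0 :: "real^'n"
  assumes "0 < \<rho>" and "\<rho> \<le> 1" and "0 \<le> \<delta>" and "\<delta> < 1" and "\<delta> \<le> \<rho>"
    and "a \<in> APS m \<rho> \<delta>"
    and "\<And>x. a (x, \<xi>\<^sub>0) = mean (\<lambda>x. a (x, \<xi>\<^sub>0))"
  shows "mean (\<lambda>x. a (x, \<xi>\<^sub>0)) \<in> ess_spectrum scale_B2 (closure (psdo a))"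
proof -
  define s where "s = mean (\<lambda>x. a (x, \<xi>\<^sub>0))"
  define T where "T = shift_op scale_B2 (closure (psdo a)) s"
  have aC: "(\<lambda>x. a (x, l)) \<in> C_ap" for l using assms(6) by (simp add: APS_def)
  have T: "T = (\<lambda>p. (fst p, snd p + scale_B2 s (fst p))) -` closure (psdo a)"
    unfolding T_def by (rule shift_op_eq_vimage)
  have lin: "bounded_linear (\<lambda>p :: 'n B2 \<times> 'n B2. (fst p, snd p + scale_B2 s (fst p)))"
    by (intro bounded_linear_Pair bounded_linear_add bounded_linear_fst bounded_linear_snd
        bounded_linear_compose[OF bounded_linear_scale_B2])
  have sub: "subspace T"
    unfolding T by (intro linear_subspace_vimage bounded_linear.linear[OF lin] subspace_closure
        subspace_psdo aC)
  have cl: "closed T"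
    unfolding T by (intro closed_vimage closed_closure linear_continuous_on lin)
  obtain i :: 'n where True by simp
  \<comment> \<open>Distinct frequencies approaching \<open>\<xi>\<^sub>0\<close> along one axis;
    \<open>Suc\<close> keeps the step within the unit interval on which the Lipschitz bound
    holds.\<close>
  define l where "l k = \<xi>\<^sub>0 + (1 / real (Suc k)) *\<^sub>R axis i 1" for k
  have inj: "l j = l k \<longleftrightarrow> j = k" for j k by (auto simp: l_def)
  define w where "w k = B2_of (expo (l k))" for k
  define v where "v k = B2_of (\<lambda>x. (a (x, l k) - s) * expo (l k) x)" for k
  have ae: "(\<lambda>x. a (x, k) * expo k x) \<in> C_ap" for k by (intro C_ap_mult aC expo_C_ap)
  have wv: "(w k, v k) \<in> T" for k
  proof -
    have "v k = B2_of (\<lambda>x. a (x, l k) * expo (l k) x - s * expo (l k) x)"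
      by (simp add: v_def left_diff_distrib)
    also have "\<dots> = B2_of (\<lambda>x. a (x, l k) * expo (l k) x) - scale_B2 s (w k)"
      by (simp add: B2_of_diff ae C_ap_scale expo_C_ap B2_of_scale w_def)
    finally have v: "v k = B2_of (\<lambda>x. a (x, l k) * expo (l k) x) - scale_B2 s (w k)" .
    have "(w k, B2_of (\<lambda>x. a (x, l k) * expo (l k) x)) \<in> psdo a"
      unfolding psdo_def w_def by (auto intro!: exI[of _ "{l k}"] exI[of _ "\<lambda>_. 1"])
    then have "(w k, B2_of (\<lambda>x. a (x, l k) * expo (l k) x)) \<in> closure (psdo a)"
      using closure_subset by blast
    then show ?thesis by (simp add: T v)
  qed
  obtain L where L: "\<And>x t. 0 \<le> t \<Longrightarrow> t \<le> 1 \<Longrightarrow>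
      norm (a (x, \<xi>\<^sub>0 + t *\<^sub>R axis i 1) - a (x, \<xi>\<^sub>0)) \<le> L * t"
    using symbol_Lipschitz_direction[OF assms(6)] by metis
  have "v \<longlonglongrightarrow> 0"
  proof (rule Lim_null_comparison)
    have "norm (v k) \<le> L * (1 / real (Suc k))" for k
    proof -
      have C: "(\<lambda>x. (a (x, l k) - s) * expo (l k) x) \<in> C_ap"
        by (intro C_ap_intros aC expo_C_ap)
      have "norm_B (\<lambda>x. (a (x, l k) - s) * expo (l k) x) \<le> L * (1 / real (Suc k))"
      proof (rule norm_B_bound[OF C])
        \<comment> \<open>The hypothesis at \<open>\<xi>\<^sub>0\<close> enters here:
          \<open>s\<close> equals \<open>a (x, \<xi>\<^sub>0)\<close> for every \<open>x\<close>, so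
          the factor is a Lipschitz increment, uniformly in \<open>x\<close>.\<close>
        show "norm ((a (x, l k) - s) * expo (l k) x) \<le> L * (1 / real (Suc k))" for x
          using L[of "1 / real (Suc k)" x] assms(7)[of x] by (simp add: norm_mult l_def s_def)
      qed
      then show ?thesis by (simp add: v_def norm_B2_of C)
    qed
    then show "\<forall>\<^sub>F k in sequentially. norm (v k) \<le> L * (1 / real (Suc k))" by simp
    show "(\<lambda>k. L * (1 / real (Suc k))) \<longlonglongrightarrow> 0"
      using tendsto_mult[OF tendsto_const[of L] LIMSEQ_inverse_real_of_nat]
      by (simp add: inverse_eq_divide)
  qed
  moreover have "w i \<bullet> w j = (if i = j then 1 else 0)" for i j
    by (simp add: w_def inner_expo_B2 inj)
  ultimately have "\<not> fredholm scale_B2 T"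
    by (rule not_fredholm_B2_Weyl[OF sub cl wv])
  then show ?thesis by (simp add: ess_spectrum_def T_def s_def)
qed

end
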